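(* Fix a class $j$ and a measurable set $W$ of feature values with $P(X\in W)>0$, in the setting described in the context, and let $I_W$ be the indicator function of $W$. Let $$\hat q_{j,W}=\frac{\sum_{i=1}^n g(X_i,\hat\theta_j)I_W(X_i)}{\sum_{i=1}^n I_W(X_i)},\qquad \bar Y^{(j,W)}=\frac{\frac1r\sum_{i=1}^r I_W(X_i)Y_i^{(j)}}{\frac1n\sum_{i=1}^n I_W(X_i)}$$ be, respectively, the estimator of $q_{j,W}=P(Y^{(j)}=1\mid X\in W)$ based on both the labeled and unlabeled data and the ordinary estimator based only on the labeled $Y$ values. Then the asymptotic variance of $\hat q_{j,W}$ is less than or equal to that of $\bar Y^{(j,W)}$. If $\gamma<1$, the inequality is strict as long as the random variable $I_W(X)g(X,\theta_j)$ is not (almost surely) constant.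
   Context: Setting. $(X,Y^{(j)}),(X_1,Y_1^{(j)}),(X_2,Y_2^{(j)}),\dots$ are i.i.d., $X$ a random feature vector in $\mathbb R^f$ and $Y^{(j)}\in\{0,1\}$ the indicator of membership in class $j$. For each $n$, all of $X_1,\dots,X_n$ are observed, but $Y_i^{(j)}$ is observed only for $i=1,\dots,r$ (labeled data), where $r=r(n)\le n$ and $r/n\to\gamma\in(0,1]$. Semiparametric model: $P(Y^{(j)}=1\mid X=t)=g(t,\theta_j)$, where $g(t,\theta)$ is a known parametric family and $\theta_j\in\mathbb R^p$ is an unknown parameter in the interior of the parameter set; the distribution of $X$ is arbitrary. $g'(t,\theta)$ is the (column) gradient of $g$ in $\theta$, and $w(t,\theta)=1/\{g(t,\theta)[1-g(t,\theta)]\}$. The estimator $\hat\theta_j$, computed from the labeled data, is a root of $0=\sum_{i=1}^r w(X_i,\hat\theta_j)\{Y_i^{(j)}-g(X_i,\hat\theta_j)\}g'(X_i,\hat\theta_j)$. Standing regularity conditions: $0<g<1$; $g(t,\cdot)$ is continuously differentiable on a convex neighborhood $U$ of $\theta_j$ with $E\sup_{\theta\in U}\|g'(X,\theta)\|<\infty$; $A_j=E\{w(X,\theta_j)g'(X,\theta_j)g'(X,\theta_j)^T\}$ is finite and invertible; and the standard asymptotic linear representation of the weighted least squares estimator holds: $r^{1/2}(\hat\theta_j-\theta_j)-r^{-1/2}A_j^{-1}\sum_{i=1}^r w(X_i,\theta_j)\{Y_i^{(j)}-g(X_i,\theta_j)\}g'(X_i,\theta_j)\to0$ in probability. Asymptotic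 variance: if $n^{1/2}(T_n-\tau)$ converges in distribution to $N(0,V)$, the asymptotic variance of the estimator $T_n$ of $\tau$ is $V/n$; comparing asymptotic variances of two estimators of $q_{j,W}$ means comparing the corresponding limiting variances $V$. *)

theory Defs
  imports "HOL-Probability.Probability"
begin

text \<open>The centred normal law with variance \<open>V\<close>. The case \<open>V = 0\<close>, which does occur as
  a limit law for the estimators below, gives the point mass at \<open>0\<close>.\<close>

definition centred_normal :: "real \<Rightarrow> real measure" where
  "centred_normal V = distr std_normal_distribution borel (\<lambda>x. sqrt V * x)"

text \<open>\<open>V\<close> is normalised as the variance of the limit law, so the asymptotic variance of
  \<open>T n\<close> itself is \<open>V / n\<close>.\<close>

definition has_limiting_variance ::
    "'a measure \<Rightarrow> (nat \<Rightarrow> 'a \<Rightarrow> real) \<Rightarrow> real \<Rightarrow> real \<Rightarrow> bool" where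
  "has_limiting_variance M T \<tau> V \<longleftrightarrow>
     0 \<le> V \<and>
     (\<forall>n. T n \<in> borel_measurable M) \<and>
     weak_conv_m (\<lambda>n. distr M borel (\<lambda>\<omega>. sqrt (real n) * (T n \<omega> - \<tau>))) (centred_normal V)"

definition tendsto_0_in_prob ::
    "'a measure \<Rightarrow> (nat \<Rightarrow> 'a \<Rightarrow> 'b::real_normed_vector) \<Rightarrow> bool" where
  "tendsto_0_in_prob M Z \<longleftrightarrow>
     (\<forall>\<epsilon>>0. (\<lambda>n. \<P>(\<omega> in M. norm (Z n \<omega>) > \<epsilon>)) \<longlonglongrightarrow> 0)"

definition gradient :: "('b::real_inner \<Rightarrow> real) \<Rightarrow> 'b \<Rightarrow> 'b" where
  "gradient f x = (THE D. GDERIV f x :> D)"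

definition weight :: "('x \<Rightarrow> 'b \<Rightarrow> real) \<Rightarrow> 'x \<Rightarrow> 'b \<Rightarrow> real" where
  "weight g t \<theta> = 1 / (g t \<theta> * (1 - g t \<theta>))"

text \<open>The contribution of one labelled observation \<open>(t, y)\<close> to the estimating equation.\<close>

definition score :: "('x \<Rightarrow> 'b::real_inner \<Rightarrow> real) \<Rightarrow> 'x \<Rightarrow> real \<Rightarrow> 'b \<Rightarrow> 'b" where
  "score g t y \<theta> = (weight g t \<theta> * (y - g t \<theta>)) *\<^sub>R gradient (g t) \<theta>"

text \<open>The matrix \<open>w g' g'\<^sup>T\<close> at feature value \<open>t\<close>, whose expectation is \<open>A\<close>.\<close>

definition info :: "('x \<Rightarrow> real^'p \<Rightarrow> real) \<Rightarrow> 'x \<Rightarrow> real^'p \<Rightarrow> real^'p^'p" where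
  "info g t \<theta> =
     weight g t \<theta> *\<^sub>R (\<chi> k l. gradient (g t) \<theta> $ k * gradient (g t) \<theta> $ l)"

text \<open>In the following, the sample consists of the observations with index \<open>\<ge> 1\<close>; \<open>X 0\<close> and
  \<open>Y 0\<close> are kept for the generic pair. An estimator is a family \<open>est\<close> of functions of the labelled
  data \<open>(X\<^sub>i, Y\<^sub>i)\<close>, \<open>1 \<le> i \<le> r n\<close>, only.\<close>

definition param_est ::
    "(nat \<Rightarrow> (nat \<Rightarrow> 'x \<times> real) \<Rightarrow> 'b) \<Rightarrow> (nat \<Rightarrow> nat) \<Rightarrow> (nat \<Rightarrow> 'a \<Rightarrow> 'x) \<Rightarrow> (nat \<Rightarrow> 'a \<Rightarrow> real) \<Rightarrow>
      nat \<Rightarrow> 'a \<Rightarrow> 'b" where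
  "param_est est r X Y n \<omega> = est n (\<lambda>i\<in>{1..r n}. (X i \<omega>, Y i \<omega>))"

definition q_hat ::
    "('x \<Rightarrow> 'b \<Rightarrow> real) \<Rightarrow> 'x set \<Rightarrow> (nat \<Rightarrow> 'a \<Rightarrow> 'x) \<Rightarrow> (nat \<Rightarrow> 'a \<Rightarrow> 'b) \<Rightarrow> nat \<Rightarrow> 'a \<Rightarrow> real" where
  "q_hat g W X \<theta>hat n \<omega> =
     (\<Sum>i=1..n. g (X i \<omega>) (\<theta>hat n \<omega>) * indicator W (X i \<omega>)) /
     (\<Sum>i=1..n. indicator W (X i \<omega>))"

definition Y_bar ::
    "(nat \<Rightarrow> nat) \<Rightarrow> 'x set \<Rightarrow> (nat \<Rightarrow> 'a \<Rightarrow> 'x) \<Rightarrow> (nat \<Rightarrow> 'a \<Rightarrow> real) \<Rightarrow> nat \<Rightarrow> 'a \<Rightarrow> real" where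
  "Y_bar r W X Y n \<omega> =
     (1 / real (r n) * (\<Sum>i=1..r n. indicator W (X i \<omega>) * Y i \<omega>)) /
     (1 / real n * (\<Sum>i=1..n. indicator W (X i \<omega>)))"

end

theory Submission
  imports Defs
begin

text \<open>
  Centring at \<open>q\<close> and linearising \<open>g\<close> in the parameter, the numerators of both estimators become,
  up to \<open>o\<^sub>P(1)\<close>, sums \<open>n\<^sup>-\<^sup>1\<^sup>/\<^sup>2 (\<Sum>\<^bsub>i \<le> r\<^esub> a\<^sub>i + \<Sum>\<^bsub>r < i \<le> n\<^esub> b\<^sub>i)\<close> of independent centred terms, so the limits
  follow from the central limit theorem for two blocks and Slutsky's lemma. With \<open>p = P(X \<in> W)\<close>,
  \<open>\<kappa> = E I\<^sub>W g\<^sup>2\<close> and \<open>B = E I\<^sub>W g'\<close> the limiting variances satisfy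
  \<open>p\<^sup>2 (V_bar - V_hat) = (p q - p\<^sup>2 q\<^sup>2) / \<gamma> + p\<^sup>2 q\<^sup>2 - \<kappa> - B\<^sup>T A\<^sup>-\<^sup>1 B / \<gamma>\<close>.
  By Cauchy-Schwarz \<open>B\<^sup>T A\<^sup>-\<^sup>1 B \<le> E I\<^sub>W g (1 - g) = p q - \<kappa>\<close>, which leaves at least
  \<open>(1 / \<gamma> - 1) Var(I\<^sub>W g)\<close>.
\<close>

section \<open>Stochastic order symbols\<close>

text \<open>The error of \<open>\<theta>hat\<close> is carried by the labelled observations alone:
  to a summand with i \<le> r it adds a multiple of the score. Given X the score has mean 0, so it
  is uncorrelated with the part that depends on X only. Hence two summand functions suffice, and
  estimating the parameter simply adds B^T A^-1 B / \<gamma> to the variance. Two obstacles shape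
  the estimates. The weight w is unbounded, so moments of the score are taken through the
  conditional law of Y, where w g (1 - g) = 1 cancels it. And g' is dominated near the true
  parameter in the first moment only, with no second derivative available; the Taylor remainder is
  therefore controlled by averages of a local modulus of continuity of g' and Markov's inequality.
  The Cauchy-Schwarz step is a projection: in L2 of the law of X with weight w, B^T A^-1 B is the
  squared length of the projection of I_W g (1 - g) onto the span of the coordinates of g', and E
  I_W g (1 - g) is the squared length of that function itself.\<close>

definition bounded_in_prob ::
    "'a measure \<Rightarrow> (nat \<Rightarrow> 'a \<Rightarrow> 'b::real_normed_vector) \<Rightarrow> bool" where
  "bounded_in_prob M Z \<longleftrightarrow>
     (\<forall>\<delta>>0. \<exists>K>0. \<forall>\<^sub>F n in sequentially. \<P>(\<omega> in M. norm (Z n \<omega>) > K) < \<delta>)"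

context prob_space
begin

lemma tendsto_0_in_probI:
  assumes "\<And>\<epsilon> \<delta>. \<epsilon> > 0 \<Longrightarrow> \<delta> > 0 \<Longrightarrow>
    \<forall>\<^sub>F n in sequentially. prob {\<omega> \<in> space M. norm (Z n \<omega>) > \<epsilon>} < \<delta>"
  shows "tendsto_0_in_prob M Z"
  unfolding tendsto_0_in_prob_def tendsto_iff using assms by (simp add: dist_real_def)

lemma tendsto_0_in_probD:
  assumes "tendsto_0_in_prob M Z" "\<epsilon> > 0" "\<delta> > 0"
  shows "\<forall>\<^sub>F n in sequentially. prob {\<omega> \<in> space M. norm (Z n \<omega>) > \<epsilon>} < \<delta>"
  using assms unfolding tendsto_0_in_prob_def tendsto_iff by (simp add: dist_real_def)

lemma prob_less_of_subset_Un:
  assumes "prob A < a" "prob B < b" "C \<subseteq> A \<union> B" "A \<in> events" "B \<in> events" "a + b \<le> c"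
  shows "prob C < c"
proof -
  have "prob C \<le> prob (A \<union> B)"
    using assms by (intro finite_measure_mono) auto
  also have "\<dots> \<le> prob A + prob B"
    using assms by (intro measure_Un_le) auto
  finally show ?thesis using assms by simp
qed

lemma tendsto_0_in_prob_mono:
  fixes Z :: "nat \<Rightarrow> 'a \<Rightarrow> 'b::{real_normed_vector, second_countable_topology}"
    and Z' :: "nat \<Rightarrow> 'a \<Rightarrow> 'c::{real_normed_vector, second_countable_topology}"
  assumes Z: "tendsto_0_in_prob M Z" and [measurable]: "\<And>n. Z n \<in> borel_measurable M"
    and le: "\<forall>\<^sub>F n in sequentially. \<forall>\<omega>\<in>space M. norm (Z' n \<omega>) \<le> norm (Z n \<omega>)"
  shows "tendsto_0_in_prob M Z'"
proof (rule tendsto_0_in_probI)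
  fix \<epsilon> \<delta> :: real assume "\<epsilon> > 0" "\<delta> > 0"
  from tendsto_0_in_probD[OF Z this] le
  show "\<forall>\<^sub>F n in sequentially. prob {\<omega> \<in> space M. norm (Z' n \<omega>) > \<epsilon>} < \<delta>"
  proof eventually_elim
    case (elim n)
    have "prob {\<omega> \<in> space M. norm (Z' n \<omega>) > \<epsilon>} \<le> prob {\<omega> \<in> space M. norm (Z n \<omega>) > \<epsilon>}"
      using elim by (intro finite_measure_mono) (auto dest: bspec intro: less_le_trans)
    then show ?case using elim by simp
  qed
qed

lemma tendsto_0_in_prob_cong:
  fixes Z Z' :: "nat \<Rightarrow> 'a \<Rightarrow> 'b::{real_normed_vector, second_countable_topology}"
  assumes "tendsto_0_in_prob M Z" "\<And>n. Z n \<in> borel_measurable M"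
    and "\<forall>\<^sub>F n in sequentially. \<forall>\<omega>\<in>space M. Z' n \<omega> = Z n \<omega>"
  shows "tendsto_0_in_prob M Z'"
  using assms(1,2) by (rule tendsto_0_in_prob_mono) (use assms(3) in \<open>auto elim: eventually_mono\<close>)

lemma tendsto_0_in_prob_add:
  fixes Z Z' :: "nat \<Rightarrow> 'a \<Rightarrow> 'b::{real_normed_vector, second_countable_topology}"
  assumes Z: "tendsto_0_in_prob M Z" and Z': "tendsto_0_in_prob M Z'"
    and [measurable]: "\<And>n. Z n \<in> borel_measurable M" "\<And>n. Z' n \<in> borel_measurable M"
  shows "tendsto_0_in_prob M (\<lambda>n \<omega>. Z n \<omega> + Z' n \<omega>)"
proof (rule tendsto_0_in_probI)
  fix \<epsilon> \<delta> :: real assume "\<epsilon> > 0" "\<delta> > 0"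
  then have "\<epsilon> / 2 > 0" "\<delta> / 2 > 0" by auto
  from tendsto_0_in_probD[OF Z this] tendsto_0_in_probD[OF Z' this]
  show "\<forall>\<^sub>F n in sequentially. prob {\<omega> \<in> space M. norm (Z n \<omega> + Z' n \<omega>) > \<epsilon>} < \<delta>"
  proof eventually_elim
    case (elim n)
    then show ?case
    proof (rule prob_less_of_subset_Un)
      have "norm (Z n \<omega> + Z' n \<omega>) > \<epsilon> \<Longrightarrow> \<not> norm (Z n \<omega>) > \<epsilon> / 2 \<Longrightarrow> norm (Z' n \<omega>) > \<epsilon> / 2" for \<omega>
        using norm_triangle_ineq[of "Z n \<omega>" "Z' n \<omega>"] by linarith
      then show "{\<omega> \<in> space M. norm (Z n \<omega> + Z' n \<omega>) > \<epsilon>} \<subseteq>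
        {\<omega> \<in> space M. norm (Z n \<omega>) > \<epsilon> / 2} \<union> {\<omega> \<in> space M. norm (Z' n \<omega>) > \<epsilon> / 2}" by auto
    qed simp_all
  qed
qed

lemma tendsto_0_in_prob_zero [simp]: "tendsto_0_in_prob M (\<lambda>n \<omega>. 0)"
  by (simp add: tendsto_0_in_prob_def)

lemma tendsto_0_in_prob_sum:
  fixes Z :: "'i \<Rightarrow> nat \<Rightarrow> 'a \<Rightarrow> 'b::{real_normed_vector, second_countable_topology}"
  assumes "finite I" "\<And>i. i \<in> I \<Longrightarrow> tendsto_0_in_prob M (Z i)"
    and "\<And>i n. i \<in> I \<Longrightarrow> Z i n \<in> borel_measurable M"
  shows "tendsto_0_in_prob M (\<lambda>n \<omega>. \<Sum>i\<in>I. Z i n \<omega>)"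
  using assms by (induction I rule: finite_induct) (auto intro!: tendsto_0_in_prob_add)

lemma tendsto_0_in_prob_mult:
  fixes Z Z' :: "nat \<Rightarrow> 'a \<Rightarrow> real"
  assumes Z: "bounded_in_prob M Z" and Z': "tendsto_0_in_prob M Z'"
    and [measurable]: "\<And>n. Z n \<in> borel_measurable M" "\<And>n. Z' n \<in> borel_measurable M"
  shows "tendsto_0_in_prob M (\<lambda>n \<omega>. Z n \<omega> * Z' n \<omega>)"
proof (rule tendsto_0_in_probI)
  fix \<epsilon> \<delta> :: real assume "\<epsilon> > 0" "\<delta> > 0"
  then have "\<delta> / 2 > 0" by auto
  with Z obtain K where K: "K > 0"
    "\<forall>\<^sub>F n in sequentially. prob {\<omega> \<in> space M. norm (Z n \<omega>) > K} < \<delta> / 2"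
    unfolding bounded_in_prob_def by blast
  have "\<epsilon> / K > 0" using K \<open>\<epsilon> > 0\<close> by simp
  from K(2) tendsto_0_in_probD[OF Z' this \<open>\<delta> / 2 > 0\<close>]
  show "\<forall>\<^sub>F n in sequentially. prob {\<omega> \<in> space M. norm (Z n \<omega> * Z' n \<omega>) > \<epsilon>} < \<delta>"
  proof eventually_elim
    case (elim n)
    then show ?case
    proof (rule prob_less_of_subset_Un)
      have "norm (Z n \<omega> * Z' n \<omega>) \<le> \<epsilon>" if "norm (Z n \<omega>) \<le> K" "norm (Z' n \<omega>) \<le> \<epsilon> / K" for \<omega>
      proof -
        have "norm (Z n \<omega>) * norm (Z' n \<omega>) \<le> K * (\<epsilon> / K)"
          using that K(1) by (intro mult_mono) auto
        then show ?thesis using K(1) by (simp add: norm_mult del: real_norm_def)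
      qed
      then show "{\<omega> \<in> space M. norm (Z n \<omega> * Z' n \<omega>) > \<epsilon>} \<subseteq>
        {\<omega> \<in> space M. norm (Z n \<omega>) > K} \<union> {\<omega> \<in> space M. norm (Z' n \<omega>) > \<epsilon> / K}"
        by (auto simp: not_less simp del: real_norm_def) (meson not_le)
    qed simp_all
  qed
qed

lemma bounded_in_prob_mono:
  fixes Z :: "nat \<Rightarrow> 'a \<Rightarrow> 'b::{real_normed_vector, second_countable_topology}"
    and Z' :: "nat \<Rightarrow> 'a \<Rightarrow> 'c::{real_normed_vector, second_countable_topology}"
  assumes Z: "bounded_in_prob M Z" and [measurable]: "\<And>n. Z n \<in> borel_measurable M"
    and le: "\<And>n \<omega>. \<omega> \<in> space M \<Longrightarrow> norm (Z' n \<omega>) \<le> norm (Z n \<omega>)"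
  shows "bounded_in_prob M Z'"
  unfolding bounded_in_prob_def
proof (intro allI impI)
  fix \<delta> :: real assume "\<delta> > 0"
  with Z obtain K where K: "K > 0"
    "\<forall>\<^sub>F n in sequentially. prob {\<omega> \<in> space M. norm (Z n \<omega>) > K} < \<delta>"
    unfolding bounded_in_prob_def by blast
  have "prob {\<omega> \<in> space M. norm (Z' n \<omega>) > K} \<le> prob {\<omega> \<in> space M. norm (Z n \<omega>) > K}" for n
    by (intro finite_measure_mono) (auto dest: le intro: less_le_trans)
  with K show "\<exists>K>0. \<forall>\<^sub>F n in sequentially. prob {\<omega> \<in> space M. norm (Z' n \<omega>) > K} < \<delta>"
    by (intro exI[of _ K]) (auto elim!: eventually_mono intro: le_less_trans)
qed

lemma bounded_in_prob_add:
  fixes Z Z' :: "nat \<Rightarrow> 'a \<Rightarrow> 'b::{real_normed_vector, second_countable_topology}"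
  assumes Z: "bounded_in_prob M Z" and Z': "bounded_in_prob M Z'"
    and [measurable]: "\<And>n. Z n \<in> borel_measurable M" "\<And>n. Z' n \<in> borel_measurable M"
  shows "bounded_in_prob M (\<lambda>n \<omega>. Z n \<omega> + Z' n \<omega>)"
  unfolding bounded_in_prob_def
proof (intro allI impI)
  fix \<delta> :: real assume "\<delta> > 0"
  then have \<delta>: "\<delta> / 2 > 0" by simp
  with Z obtain K where K: "K > 0"
    "\<forall>\<^sub>F n in sequentially. prob {\<omega> \<in> space M. norm (Z n \<omega>) > K} < \<delta> / 2"
    unfolding bounded_in_prob_def by blast
  from \<delta> Z' obtain L where L: "L > 0"
    "\<forall>\<^sub>F n in sequentially. prob {\<omega> \<in> space M. norm (Z' n \<omega>) > L} < \<delta> / 2"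
    unfolding bounded_in_prob_def by blast
  from K(2) L(2)
  have "\<forall>\<^sub>F n in sequentially. prob {\<omega> \<in> space M. norm (Z n \<omega> + Z' n \<omega>) > K + L} < \<delta>"
  proof eventually_elim
    case (elim n)
    then show ?case
    proof (rule prob_less_of_subset_Un)
      have "norm (Z n \<omega> + Z' n \<omega>) > K + L \<Longrightarrow> \<not> norm (Z n \<omega>) > K \<Longrightarrow> norm (Z' n \<omega>) > L" for \<omega>
        using norm_triangle_ineq[of "Z n \<omega>" "Z' n \<omega>"] by linarith
      then show "{\<omega> \<in> space M. norm (Z n \<omega> + Z' n \<omega>) > K + L} \<subseteq>
        {\<omega> \<in> space M. norm (Z n \<omega>) > K} \<union> {\<omega> \<in> space M. norm (Z' n \<omega>) > L}" by auto
    qed simp_all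
  qed
  then show "\<exists>K>0. \<forall>\<^sub>F n in sequentially. prob {\<omega> \<in> space M. norm (Z n \<omega> + Z' n \<omega>) > K} < \<delta>"
    using K L by (intro exI[of _ "K + L"]) simp
qed

lemma bounded_in_prob_sum:
  fixes Z :: "'i \<Rightarrow> nat \<Rightarrow> 'a \<Rightarrow> 'b::{real_normed_vector, second_countable_topology}"
  assumes "finite I" "\<And>i. i \<in> I \<Longrightarrow> bounded_in_prob M (Z i)"
    and "\<And>i n. i \<in> I \<Longrightarrow> Z i n \<in> borel_measurable M"
  shows "bounded_in_prob M (\<lambda>n \<omega>. \<Sum>i\<in>I. Z i n \<omega>)"
  using assms
proof (induction I rule: finite_induct)
  case empty
  then show ?case by (auto simp: bounded_in_prob_def intro!: exI[of _ "1::real"])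
qed (auto intro!: bounded_in_prob_add)

text \<open>The threshold 1 works for every \<open>\<delta>\<close>, because tightness is demanded
  only for all large n; the first terms of the sequence need no control.\<close>

lemma tendsto_0_in_prob_imp_bounded:
  assumes "tendsto_0_in_prob M Z"
  shows "bounded_in_prob M Z"
  unfolding bounded_in_prob_def
  using tendsto_0_in_probD[OF assms zero_less_one] by (auto intro!: exI[of _ "1::real"])

lemma bounded_in_prob_const:
  fixes c :: "nat \<Rightarrow> 'b::real_normed_vector"
  assumes "c \<longlonglongrightarrow> l"
  shows "bounded_in_prob M (\<lambda>n \<omega>. c n)"
proof -
  obtain K where "K > 0" and K: "\<And>n. norm (c n) \<le> K"
    using convergent_imp_Bseq[of c] assms by (auto simp: convergent_def Bseq_def)
  then have "prob {\<omega> \<in> space M. norm (c n) > K} = 0" for n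
    by (simp add: not_less[symmetric])
  with \<open>K > 0\<close> show ?thesis
    unfolding bounded_in_prob_def by (intro allI impI exI[of _ K]) simp
qed

lemma tendsto_0_in_prob_const:
  fixes c :: "nat \<Rightarrow> 'b::real_normed_vector"
  assumes "c \<longlonglongrightarrow> 0"
  shows "tendsto_0_in_prob M (\<lambda>n \<omega>. c n)"
proof (rule tendsto_0_in_probI)
  fix \<epsilon> \<delta> :: real assume "\<epsilon> > 0" "\<delta> > 0"
  then have "\<forall>\<^sub>F n in sequentially. norm (c n) < \<epsilon>"
    using assms by (simp add: tendsto_iff)
  then show "\<forall>\<^sub>F n in sequentially. prob {\<omega> \<in> space M. norm (c n) > \<epsilon>} < \<delta>"
    by eventually_elim (use \<open>\<delta> > 0\<close> in auto)
qed

lemma prob_gt_le_second_moment: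
  fixes V :: "'a \<Rightarrow> real"
  assumes [measurable]: "V \<in> borel_measurable M"
    and "integrable M (\<lambda>\<omega>. (V \<omega>)\<^sup>2)" "K > 0"
  shows "prob {\<omega> \<in> space M. norm (V \<omega>) > K} \<le> expectation (\<lambda>\<omega>. (V \<omega>)\<^sup>2) / K\<^sup>2"
proof -
  have "prob {\<omega> \<in> space M. norm (V \<omega>) > K} \<le> prob {\<omega> \<in> space M. (V \<omega>)\<^sup>2 \<ge> K\<^sup>2}"
    using \<open>K > 0\<close> by (intro finite_measure_mono) (auto simp: abs_le_square_iff[symmetric])
  also have "\<dots> \<le> expectation (\<lambda>\<omega>. (V \<omega>)\<^sup>2) / K\<^sup>2"
    using assms by (intro integral_Markov_inequality_measure[where A="space M"]) auto
  finally show ?thesis .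
qed

lemma bounded_in_prob_second_moment:
  fixes Z :: "nat \<Rightarrow> 'a \<Rightarrow> real"
  assumes [measurable]: "\<And>n. Z n \<in> borel_measurable M"
    and int: "\<And>n. integrable M (\<lambda>\<omega>. (Z n \<omega>)\<^sup>2)"
    and le: "\<And>n. expectation (\<lambda>\<omega>. (Z n \<omega>)\<^sup>2) \<le> C"
  shows "bounded_in_prob M Z"
  unfolding bounded_in_prob_def
proof (intro allI impI)
  fix \<delta> :: real assume "\<delta> > 0"
  have "C \<ge> 0" using le[of 0] by (intro order_trans[OF integral_nonneg_AE]) auto
  define K where "K = sqrt ((C + 1) / \<delta>)"
  have K: "K > 0" "K\<^sup>2 = (C + 1) / \<delta>"
    using \<open>C \<ge> 0\<close> \<open>\<delta> > 0\<close> by (auto simp: K_def)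
  have "prob {\<omega> \<in> space M. norm (Z n \<omega>) > K} < \<delta>" for n
  proof -
    have "prob {\<omega> \<in> space M. norm (Z n \<omega>) > K} \<le> expectation (\<lambda>\<omega>. (Z n \<omega>)\<^sup>2) / K\<^sup>2"
      using int K by (intro prob_gt_le_second_moment) auto
    also have "\<dots> \<le> C / K\<^sup>2"
      using le by (intro divide_right_mono) auto
    also have "\<dots> < \<delta>"
      using \<open>C \<ge> 0\<close> \<open>\<delta> > 0\<close> unfolding K by (simp add: field_simps)
    finally show ?thesis .
  qed
  with K show "\<exists>K>0. \<forall>\<^sub>F n in sequentially. prob {\<omega> \<in> space M. norm (Z n \<omega>) > K} < \<delta>" by auto
qed

section \<open>Slutsky's lemma\<close>

text \<open>Multiplying by a unimodular factor shows that the two integrands differ by |1 - exp(i t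
  R)|, which is at most |t R| and at most 2. The first bound serves where R is small, the second on
  the exceptional event. The limit \<open>l\<close> is an arbitrary number, so Levy's theorem is
  invoked only once, at the very end.\<close>

lemma char_tendsto_Slutsky:
  fixes S R :: "nat \<Rightarrow> 'a \<Rightarrow> real"
  assumes R: "tendsto_0_in_prob M R"
    and [measurable]: "\<And>n. S n \<in> borel_measurable M" "\<And>n. R n \<in> borel_measurable M"
    and lim: "(\<lambda>n. char (distr M borel (S n)) t) \<longlonglongrightarrow> l"
  shows "(\<lambda>n. char (distr M borel (\<lambda>\<omega>. S n \<omega> + R n \<omega>)) t) \<longlonglongrightarrow> l"
proof (rule Lim_transform[OF lim], unfold tendsto_iff, intro allI impI)
  fix e :: real assume "e > 0"
  \<comment> \<open>The region where R is small contributes at most |t| \<open>\<epsilon>\<close> <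
    e / 2, the exceptional event of probability below e / 4 at most twice that. The summand 1 covers
    t = 0.\<close>
  define \<epsilon> where "\<epsilon> = e / (2 * (\<bar>t\<bar> + 1))"
  have \<epsilon>: "\<epsilon> > 0" "\<bar>t\<bar> * \<epsilon> < e / 2"
    using \<open>e > 0\<close> by (auto simp: \<epsilon>_def field_simps intro: add_pos_nonneg)
  have "e / 4 > 0" using \<open>e > 0\<close> by simp
  from tendsto_0_in_probD[OF R \<epsilon>(1) this]
  show "\<forall>\<^sub>F n in sequentially. dist (char (distr M borel (\<lambda>\<omega>. S n \<omega> + R n \<omega>)) t -
      char (distr M borel (S n)) t) 0 < e"
  proof eventually_elim
    case (elim n)
    let ?A = "{\<omega> \<in> space M. norm (R n \<omega>) > \<epsilon>}"
    have int: "integrable M (\<lambda>\<omega>. iexp (t * f \<omega>))" if "f \<in> borel_measurable M" for f :: "'a \<Rightarrow> real"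
      using that by (intro integrable_const_bound[where B=1]) auto
    have i1: "integrable M (\<lambda>\<omega>. iexp (t * S n \<omega>))" and i2: "integrable M (\<lambda>\<omega>. iexp (t * (S n \<omega> + R n \<omega>)))"
      by (simp_all only: int borel_measurable_add assms)
    have ind: "integrable M (indicat_real ?A)"
      by (intro integrable_real_indicator) (auto simp: less_top[symmetric])
    have bnd: "norm (iexp (t * S n \<omega>) - iexp (t * (S n \<omega> + R n \<omega>))) \<le> \<bar>t\<bar> * \<epsilon> + 2 * indicator ?A \<omega>"
      if "\<omega> \<in> space M" for \<omega>
    proof -
      have *: "iexp (t * S n \<omega>) - iexp (t * (S n \<omega> + R n \<omega>)) = iexp (t * S n \<omega>) * (1 - iexp (t * R n \<omega>))"
        by (simp add: algebra_simps exp_add)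
      have **: "norm (1 - iexp (t * R n \<omega>)) \<le> \<bar>t * R n \<omega>\<bar>"
        using iexp_approx1[of "t * R n \<omega>" 0] by (simp add: norm_minus_commute)
      have ***: "norm (1 - iexp (t * R n \<omega>)) \<le> 2"
        by (rule order_trans[OF norm_triangle_ineq4]) simp
      show ?thesis
      proof (cases "\<omega> \<in> ?A")
        case True
        then show ?thesis unfolding * norm_mult using *** \<epsilon>
          by (simp add: add_increasing)
      next
        case False
        then have "\<bar>t * R n \<omega>\<bar> \<le> \<bar>t\<bar> * \<epsilon>"
          using that by (auto simp: abs_mult intro!: mult_left_mono)
        with False ** show ?thesis unfolding * norm_mult by simp
      qed
    qed
    have "char (distr M borel (S n)) t - char (distr M borel (\<lambda>\<omega>. S n \<omega> + R n \<omega>)) t =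
      (CLINT \<omega>|M. iexp (t * S n \<omega>) - iexp (t * (S n \<omega> + R n \<omega>)))"
      unfolding char_def by (subst (1 2) integral_distr) (simp_all add: i1 i2 del: of_real_add of_real_mult)
    also have "norm \<dots> \<le> (LINT \<omega>|M. norm (iexp (t * S n \<omega>) - iexp (t * (S n \<omega> + R n \<omega>))))"
      by (rule integral_norm_bound)
    also have "\<dots> \<le> (LINT \<omega>|M. \<bar>t\<bar> * \<epsilon> + 2 * indicator ?A \<omega>)"
    proof (rule integral_mono)
      show "integrable M (\<lambda>\<omega>. norm (iexp (t * S n \<omega>) - iexp (t * (S n \<omega> + R n \<omega>))))"
        using i1 i2 by (intro integrable_norm Bochner_Integration.integrable_diff)
      show "integrable M (\<lambda>\<omega>. \<bar>t\<bar> * \<epsilon> + 2 * indicator ?A \<omega>)"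
        by (intro Bochner_Integration.integrable_add integrable_const integrable_mult_right ind)
    qed (rule bnd)
    also have "\<dots> = \<bar>t\<bar> * \<epsilon> + 2 * prob ?A"
      using ind by (simp add: prob_space)
    also have "\<dots> < e"
      using elim \<epsilon> by simp
    finally show ?case by (simp add: dist_norm norm_minus_commute)
  qed
qed

section \<open>Sums of independent variables\<close>

text \<open>Each new summand is independent of the partial sum and both are centred, so the mixed
  term has mean 0. The summands may have different laws, as the two blocks require.\<close>

lemma second_moment_sum:
  fixes V :: "'i \<Rightarrow> 'a \<Rightarrow> real"
  assumes "finite J" "indep_vars (\<lambda>_. borel) V J"
    and "\<And>i. i \<in> J \<Longrightarrow> integrable M (\<lambda>\<omega>. (V i \<omega>)\<^sup>2)"
    and "\<And>i. i \<in> J \<Longrightarrow> expectation (V i) = 0"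
  shows "integrable M (\<lambda>\<omega>. (\<Sum>i\<in>J. V i \<omega>)\<^sup>2) \<and>
    expectation (\<lambda>\<omega>. (\<Sum>i\<in>J. V i \<omega>)\<^sup>2) = (\<Sum>i\<in>J. expectation (\<lambda>\<omega>. (V i \<omega>)\<^sup>2))"
  using assms
proof (induction J rule: finite_induct)
  case (insert j J)
  have ind: "indep_vars (\<lambda>_. borel) V J"
    using insert.prems(1) by (rule indep_vars_subset) auto
  have meas: "V i \<in> borel_measurable M" if "i \<in> insert j J" for i
    using insert.prems(1) that by (auto simp: indep_vars_def)
  have IH: "integrable M (\<lambda>\<omega>. (\<Sum>i\<in>J. V i \<omega>)\<^sup>2)"
    "expectation (\<lambda>\<omega>. (\<Sum>i\<in>J. V i \<omega>)\<^sup>2) = (\<Sum>i\<in>J. expectation (\<lambda>\<omega>. (V i \<omega>)\<^sup>2))"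
    using insert.IH[OF ind] insert.prems(2,3) by auto
  have int: "integrable M (V i)" if "i \<in> insert j J" for i
    by (rule square_integrable_imp_integrable[OF meas[OF that] insert.prems(2)[OF that]])
  have iv: "indep_var borel (V j) borel (\<lambda>\<omega>. \<Sum>i\<in>J. V i \<omega>)"
    using insert by (intro indep_vars_sum) auto
  have iS: "integrable M (\<lambda>\<omega>. \<Sum>i\<in>J. V i \<omega>)"
    using int by auto
  have ip: "integrable M (\<lambda>\<omega>. V j \<omega> * (\<Sum>i\<in>J. V i \<omega>))"
    using indep_var_integrable[OF iv] int iS by auto
  have "expectation (\<lambda>\<omega>. V j \<omega> * (\<Sum>i\<in>J. V i \<omega>)) = 0"
    using indep_var_lebesgue_integral[OF iv] int iS insert.prems(3) by auto
  moreover have eq: "(\<lambda>\<omega>. (\<Sum>i\<in>insert j J. V i \<omega>)\<^sup>2) =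
    (\<lambda>\<omega>. (V j \<omega>)\<^sup>2 + 2 * (V j \<omega> * (\<Sum>i\<in>J. V i \<omega>)) + (\<Sum>i\<in>J. V i \<omega>)\<^sup>2)"
    using insert.hyps by (auto simp: power2_sum algebra_simps)
  ultimately show ?case
    unfolding eq using insert.hyps insert.prems IH ip by simp
qed simp

end

section \<open>Limits of powers of characteristic functions\<close>

text \<open>The exponent is a block size of order \<open>\<kappa>\<close> n while the normalisation
  stays n. Writing the power as exp((k / n) * (n ln(1 - x / n))) separates the two limits and also
  allows \<open>\<kappa>\<close> = 0.\<close>

lemma one_minus_power_tendsto_exp:
  fixes x \<kappa> :: real and k :: "nat \<Rightarrow> nat"
  assumes k: "(\<lambda>n. real (k n) / real n) \<longlonglongrightarrow> \<kappa>"
  shows "(\<lambda>n. (1 - x / real n) ^ k n) \<longlonglongrightarrow> exp (- \<kappa> * x)"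
proof -
  have "(\<lambda>n. x / real n) \<longlonglongrightarrow> 0"
    by (rule lim_const_over_n)
  then have "\<forall>\<^sub>F n in sequentially. x / real n < 1"
    by (rule order_tendstoD) simp
  then have pos: "\<forall>\<^sub>F n in sequentially. 1 - x / real n > 0"
    by eventually_elim simp
  have "(\<lambda>n. ln ((1 + (- x) / real n) ^ n)) \<longlonglongrightarrow> ln (exp (- x))"
    by (intro tendsto_ln tendsto_exp_limit_sequentially) simp
  moreover have "\<forall>\<^sub>F n in sequentially. ln ((1 + (- x) / real n) ^ n) = real n * ln (1 - x / real n)"
    using pos by eventually_elim (simp add: ln_realpow)
  ultimately have "(\<lambda>n. real n * ln (1 - x / real n)) \<longlonglongrightarrow> - x"
    by (auto elim: Lim_transform_eventually)
  then have "(\<lambda>n. exp (real (k n) / real n * (real n * ln (1 - x / real n)))) \<longlonglongrightarrow> exp (\<kappa> * - x)"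
    by (intro tendsto_exp tendsto_mult k)
  moreover have "\<forall>\<^sub>F n in sequentially. exp (real (k n) / real n * (real n * ln (1 - x / real n))) =
      (1 - x / real n) ^ k n"
    using pos eventually_gt_at_top[of 0]
  proof eventually_elim
    case (elim n)
    then have "exp (real (k n) / real n * (real n * ln (1 - x / real n))) =
        exp (real (k n) * ln (1 - x / real n))"
      by simp
    with elim show ?case
      by (simp add: exp_of_nat_mult)
  qed
  ultimately show ?thesis
    by (auto elim: Lim_transform_eventually)
qed

lemma real_distribution_centred_normal: "real_distribution (centred_normal V)"
  unfolding centred_normal_def
  by (intro prob_space.real_distribution_distr real_distribution.axioms(1) real_dist_normal_dist) simp

lemma char_centred_normal:
  assumes "V \<ge> 0"
  shows "char (centred_normal V) t = of_real (exp (- (V * t\<^sup>2) / 2))"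
proof -
  have "char (centred_normal V) t = char std_normal_distribution (sqrt V * t)"
    unfolding centred_normal_def char_def by (subst integral_distr) (auto simp: mult_ac)
  then show ?thesis
    using assms by (simp add: char_std_normal_distribution power_mult_distrib)
qed

context prob_space
begin

text \<open>Central limit theorem for one block of k n summands normalised by sqrt n. The
  second-order expansion of the characteristic function has an error o(1 / n), and taking the k-th
  power multiplies that error by at most k \<le> n. The value \<open>\<kappa>\<close> = 0 occurs for
  the unlabelled block when all but a vanishing fraction of the data are labelled.\<close>

lemma char_power_tendsto:
  fixes V :: "'a \<Rightarrow> real" and k :: "nat \<Rightarrow> nat"
  assumes [measurable]: "V \<in> borel_measurable M"
    and sq: "integrable M (\<lambda>\<omega>. (V \<omega>)\<^sup>2)" and mean: "expectation V = 0"
    and k: "(\<lambda>n. real (k n) / real n) \<longlonglongrightarrow> \<kappa>" "\<And>n. k n \<le> n"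
  shows "(\<lambda>n. char (distr M borel V) (t / sqrt (real n)) ^ k n) \<longlonglongrightarrow>
    of_real (exp (- (\<kappa> * expectation (\<lambda>\<omega>. (V \<omega>)\<^sup>2) * t\<^sup>2) / 2))"
proof -
  define v where "v = expectation (\<lambda>\<omega>. (V \<omega>)\<^sup>2)"
  define \<phi> where "\<phi> n = char (distr M borel V) (t / sqrt (real n))" for n
  define \<psi> where "\<psi> n = 1 - t\<^sup>2 * v / 2 / real n" for n
  \<comment> \<open>The minimum makes second moments enough: its first branch gives an integrable
    dominating function, its second the pointwise convergence to 0.\<close>
  define R where "R n = expectation (\<lambda>\<omega>. min (6 * (V \<omega>)\<^sup>2) (\<bar>t / sqrt (real n)\<bar> * \<bar>V \<omega>\<bar> ^ 3))" for n
  have intV: "integrable M V"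
    by (rule square_integrable_imp_integrable[OF assms(1) sq])
  interpret D: real_distribution "distr M borel V"
    by (rule real_distribution_distr) simp
  have v: "v \<ge> 0" unfolding v_def by simp
  have R: "R \<longlonglongrightarrow> 0"
  proof -
    have "(\<lambda>n. t / sqrt (real n)) \<longlonglongrightarrow> 0"
      by (intro tendsto_divide_0[OF tendsto_const] filterlim_at_top_imp_at_infinity
        filterlim_compose[OF sqrt_at_top] filterlim_real_sequentially)
    then have *: "(\<lambda>n. min (6 * x\<^sup>2) (\<bar>t / sqrt (real n)\<bar> * \<bar>x\<bar> ^ 3)) \<longlonglongrightarrow> min (6 * x\<^sup>2) (\<bar>0\<bar> * \<bar>x\<bar> ^ 3)" for x
      by (intro tendsto_intros)
    have "R \<longlonglongrightarrow> expectation (\<lambda>\<omega>. 0)"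
      unfolding R_def
    proof (rule integral_dominated_convergence[where w="\<lambda>\<omega>. 6 * (V \<omega>)\<^sup>2"])
      show "AE \<omega> in M. (\<lambda>n. min (6 * (V \<omega>)\<^sup>2) (\<bar>t / sqrt (real n)\<bar> * \<bar>V \<omega>\<bar> ^ 3)) \<longlonglongrightarrow> 0"
        using * by (simp add: min_absorb2)
      show "integrable M (\<lambda>\<omega>. 6 * (V \<omega>)\<^sup>2)" using sq by simp
    qed auto
    then show ?thesis by simp
  qed
  have ev: "\<forall>\<^sub>F n in sequentially. norm (\<phi> n ^ k n - of_real (\<psi> n) ^ k n) \<le> t\<^sup>2 / 6 * R n"
  proof (rule eventually_sequentiallyI)
    fix n :: nat
    \<comment> \<open>From this n on, \<open>\<psi> n\<close> lies in [0, 1]. Comparing powers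
      through the difference of their bases needs both bases in the unit disc.\<close>
    assume "n \<ge> nat \<lceil>t\<^sup>2 * v\<rceil> + 1"
    then have n: "real n \<ge> t\<^sup>2 * v" "n > 0" by linarith+
    have "norm (\<phi> n - of_real (\<psi> n)) \<le> (t / sqrt (real n))\<^sup>2 / 6 * R n"
    proof -
      have "norm (\<phi> n - (1 - (t / sqrt (real n))\<^sup>2 * v / 2)) \<le> (t / sqrt (real n))\<^sup>2 / 6 * R n"
        unfolding \<phi>_def R_def
        by (rule char_approx3') (use intV sq mean in \<open>simp_all add: v_def\<close>)
      moreover have "of_real (\<psi> n) = (1 - (t / sqrt (real n))\<^sup>2 * v / 2 :: complex)"
        using n by (simp add: \<psi>_def power_divide flip: of_real_power)
      ultimately show ?thesis by simp
    qed
    then have 1: "norm (\<phi> n - of_real (\<psi> n)) \<le> t\<^sup>2 / real n / 6 * R n"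
      by (simp add: power_divide)
    have R0: "R n \<ge> 0" unfolding R_def by (intro integral_nonneg_AE) auto
    have "0 \<le> t\<^sup>2 * v / 2 / real n" "t\<^sup>2 * v / 2 / real n \<le> 1"
      using n v by (auto simp: divide_le_eq)
    then have "\<bar>\<psi> n\<bar> \<le> 1" by (simp add: \<psi>_def)
    then have "norm (\<phi> n ^ k n - of_real (\<psi> n) ^ k n) \<le> k n * norm (\<phi> n - of_real (\<psi> n))"
      by (intro norm_power_diff) (auto simp: \<phi>_def D.cmod_char_le_1)
    also have "\<dots> \<le> n * (t\<^sup>2 / real n / 6 * R n)"
      using k(2) R0 by (intro mult_mono 1) auto
    also have "\<dots> = t\<^sup>2 / 6 * R n" using n by simp
    finally show "norm (\<phi> n ^ k n - of_real (\<psi> n) ^ k n) \<le> t\<^sup>2 / 6 * R n" .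
  qed
  have "(\<lambda>n. t\<^sup>2 / 6 * R n) \<longlonglongrightarrow> 0"
    using tendsto_mult[OF tendsto_const R] by simp
  then have "(\<lambda>n. \<phi> n ^ k n - of_real (\<psi> n) ^ k n) \<longlonglongrightarrow> 0"
    using Lim_null_comparison[OF ev] by simp
  moreover have "(\<lambda>n. of_real (\<psi> n ^ k n)) \<longlonglongrightarrow> (of_real (exp (- \<kappa> * (t\<^sup>2 * v / 2))) :: complex)"
    unfolding \<psi>_def by (intro tendsto_of_real one_minus_power_tendsto_exp k)
  ultimately have "(\<lambda>n. \<phi> n ^ k n) \<longlonglongrightarrow> of_real (exp (- \<kappa> * (t\<^sup>2 * v / 2)))"
    unfolding of_real_power by (blast intro: Lim_transform)
  then show ?thesis
    by (simp add: \<phi>_def v_def mult_ac)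
qed

end

section \<open>Partially labelled samples\<close>

locale labelled_sample = prob_space M
  for M :: "'a measure" and N :: "'z measure" and Z :: "nat \<Rightarrow> 'a \<Rightarrow> 'z"
    and r :: "nat \<Rightarrow> nat" and \<gamma> :: real +
  assumes indep_Z: "indep_vars (\<lambda>_. N) Z UNIV"
    and ident_Z: "distr M N (Z i) = distr M N (Z 0)"
    and r_le: "r n \<le> n"
    and r_lim: "(\<lambda>n. real (r n) / real n) \<longlonglongrightarrow> \<gamma>"
    and \<gamma>_pos: "0 < \<gamma>" and \<gamma>_le: "\<gamma> \<le> 1"
begin

lemma measurable_Z [measurable]: "Z i \<in> measurable M N"
  using indep_Z by (auto simp: indep_vars_def)

lemma integral_Z:
  fixes f :: "'z \<Rightarrow> real"
  assumes [measurable]: "f \<in> borel_measurable N"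
  shows "expectation (\<lambda>\<omega>. f (Z i \<omega>)) = expectation (\<lambda>\<omega>. f (Z 0 \<omega>))"
proof -
  have "expectation (\<lambda>\<omega>. f (Z i \<omega>)) = integral\<^sup>L (distr M N (Z i)) f"
    by (rule integral_distr[symmetric]) auto
  also have "\<dots> = expectation (\<lambda>\<omega>. f (Z 0 \<omega>))"
    unfolding ident_Z[of i] by (rule integral_distr) auto
  finally show ?thesis .
qed

lemma integrable_Z:
  fixes f :: "'z \<Rightarrow> real"
  assumes [measurable]: "f \<in> borel_measurable N"
  shows "integrable M (\<lambda>\<omega>. f (Z i \<omega>)) \<longleftrightarrow> integrable M (\<lambda>\<omega>. f (Z 0 \<omega>))"
proof -
  have "integrable M (\<lambda>\<omega>. f (Z i \<omega>)) \<longleftrightarrow> integrable (distr M N (Z i)) f"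
    by (rule integrable_distr_eq[symmetric]) auto
  also have "\<dots> \<longleftrightarrow> integrable M (\<lambda>\<omega>. f (Z 0 \<omega>))"
    unfolding ident_Z[of i] by (rule integrable_distr_eq) auto
  finally show ?thesis .
qed

lemma nn_integral_Z:
  assumes [measurable]: "f \<in> borel_measurable N"
  shows "(\<integral>\<^sup>+\<omega>. f (Z i \<omega>) \<partial>M) = (\<integral>\<^sup>+\<omega>. f (Z 0 \<omega>) \<partial>M)"
proof -
  have "(\<integral>\<^sup>+\<omega>. f (Z i \<omega>) \<partial>M) = integral\<^sup>N (distr M N (Z i)) f"
    by (rule nn_integral_distr[symmetric]) auto
  also have "\<dots> = (\<integral>\<^sup>+\<omega>. f (Z 0 \<omega>) \<partial>M)"
    unfolding ident_Z[of i] by (rule nn_integral_distr) auto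
  finally show ?thesis .
qed

definition centred_L2 :: "('z \<Rightarrow> real) \<Rightarrow> bool" where
  "centred_L2 f \<longleftrightarrow> f \<in> borel_measurable N \<and> integrable M (\<lambda>\<omega>. (f (Z 0 \<omega>))\<^sup>2) \<and>
    expectation (\<lambda>\<omega>. f (Z 0 \<omega>)) = 0"

lemma centred_L2_zero [simp]: "centred_L2 (\<lambda>_. 0)"
  by (simp add: centred_L2_def)

text \<open>An unlabelled observation enters through X only, hence the separate function
  \<open>h\<close>; \<open>h\<close> = 0 describes a statistic of the labelled data. The common
  factor 1 / sqrt n sits inside the sum so that this is literally a sum of independent
  variables.\<close>

definition block_sum :: "('z \<Rightarrow> real) \<Rightarrow> ('z \<Rightarrow> real) \<Rightarrow> nat \<Rightarrow> 'a \<Rightarrow> real" where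
  "block_sum f h n \<omega> = (\<Sum>i=1..n. (if i \<le> r n then f (Z i \<omega>) else h (Z i \<omega>)) / sqrt (real n))"

lemma block_sum_all: "block_sum f f n \<omega> = (\<Sum>i=1..n. f (Z i \<omega>)) / sqrt (real n)"
  by (simp add: block_sum_def sum_divide_distrib)

lemma block_sum_labelled:
  "block_sum f (\<lambda>_. 0) n \<omega> = (\<Sum>i=1..r n. f (Z i \<omega>)) / sqrt (real n)"
proof -
  have "{1..n} \<inter> {i. i \<le> r n} = {1..r n}" using r_le[of n] by auto
  then show ?thesis
    unfolding block_sum_def sum_divide_distrib[symmetric] by (simp add: sum.If_cases)
qed

lemma block_sum_add:
  "block_sum f h n \<omega> + block_sum f' h' n \<omega> = block_sum (\<lambda>z. f z + f' z) (\<lambda>z. h z + h' z) n \<omega>"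
  unfolding block_sum_def sum.distrib[symmetric]
  by (intro sum.cong) (auto simp: add_divide_distrib)

lemma block_sum_cmult:
  "c * block_sum f h n \<omega> = block_sum (\<lambda>z. c * f z) (\<lambda>z. c * h z) n \<omega>"
  unfolding block_sum_def sum_distrib_left by (intro sum.cong) auto

lemma borel_measurable_block_sum:
  assumes [measurable]: "f \<in> borel_measurable N" "h \<in> borel_measurable N"
  shows "block_sum f h n \<in> borel_measurable M"
  unfolding block_sum_def[abs_def] by measurable

lemma block_sum_indep:
  assumes [measurable]: "f \<in> borel_measurable N" "h \<in> borel_measurable N"
  shows "indep_vars (\<lambda>_. borel)
    (\<lambda>i \<omega>. (if i \<le> r n then f (Z i \<omega>) else h (Z i \<omega>)) / sqrt (real n)) {1..n}"
  using indep_vars_compose2[OF indep_vars_subset[OF indep_Z, of "{1..n}"],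
      of "\<lambda>i z. (if i \<le> r n then f z else h z) / sqrt (real n)" "\<lambda>_. borel"]
  by simp

lemma bounded_in_prob_block_sum:
  assumes f: "centred_L2 f" and h: "centred_L2 h"
  shows "bounded_in_prob M (block_sum f h)"
proof -
  have [measurable]: "f \<in> borel_measurable N" "h \<in> borel_measurable N"
    using f h by (auto simp: centred_L2_def)
  define vf vh where "vf = expectation (\<lambda>\<omega>. (f (Z 0 \<omega>))\<^sup>2)" and "vh = expectation (\<lambda>\<omega>. (h (Z 0 \<omega>))\<^sup>2)"
  have nonneg: "vf \<ge> 0" "vh \<ge> 0" by (auto simp: vf_def vh_def)
  define V where "V n i \<omega> = (if i \<le> r n then f (Z i \<omega>) else h (Z i \<omega>)) / sqrt (real n)" for n i \<omega>
  have int: "integrable M (\<lambda>\<omega>. (f (Z i \<omega>))\<^sup>2)" "integrable M (\<lambda>\<omega>. (h (Z i \<omega>))\<^sup>2)" for i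
    using f h integrable_Z[of "\<lambda>z. (f z)\<^sup>2" i] integrable_Z[of "\<lambda>z. (h z)\<^sup>2" i]
    by (auto simp: centred_L2_def)
  have E2: "expectation (\<lambda>\<omega>. (f (Z i \<omega>))\<^sup>2) = vf" "expectation (\<lambda>\<omega>. (h (Z i \<omega>))\<^sup>2) = vh" for i
    using integral_Z[of "\<lambda>z. (f z)\<^sup>2" i] integral_Z[of "\<lambda>z. (h z)\<^sup>2" i]
    by (auto simp: vf_def vh_def)
  have E1: "expectation (\<lambda>\<omega>. f (Z i \<omega>)) = 0" "expectation (\<lambda>\<omega>. h (Z i \<omega>)) = 0" for i
    using f h integral_Z[of f i] integral_Z[of h i] by (auto simp: centred_L2_def)
  have V1: "expectation (V n i) = 0" for n i
    using E1[of i] by (cases "i \<le> r n") (auto simp: V_def[abs_def])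
  have V2: "integrable M (\<lambda>\<omega>. (V n i \<omega>)\<^sup>2)" for n i
    using int[of i] by (cases "i \<le> r n") (auto simp: V_def[abs_def] power_divide)
  have V3: "expectation (\<lambda>\<omega>. (V n i \<omega>)\<^sup>2) \<le> (vf + vh) / n" for n i
    using E2[of i] nonneg by (cases "i \<le> r n") (auto simp: V_def[abs_def] power_divide divide_right_mono)
  have eq: "block_sum f h n = (\<lambda>\<omega>. \<Sum>i=1..n. V n i \<omega>)" for n
    by (simp add: block_sum_def[abs_def] V_def)
  note second = second_moment_sum[of "{1..n}" "V n" for n]
  have ind: "indep_vars (\<lambda>_. borel) (V n) {1..n}" for n
    unfolding V_def[abs_def] by (rule block_sum_indep) auto
  show ?thesis
  proof (rule bounded_in_prob_second_moment[where C="vf + vh"])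
    fix n
    show "block_sum f h n \<in> borel_measurable M" by (rule borel_measurable_block_sum) auto
    show "integrable M (\<lambda>\<omega>. (block_sum f h n \<omega>)\<^sup>2)"
      unfolding eq using second[OF _ ind V2 V1] by auto
    have "expectation (\<lambda>\<omega>. (block_sum f h n \<omega>)\<^sup>2) = (\<Sum>i=1..n. expectation (\<lambda>\<omega>. (V n i \<omega>)\<^sup>2))"
      unfolding eq using second[OF _ ind V2 V1] by auto
    also have "\<dots> \<le> (\<Sum>i=1..n. (vf + vh) / n)"
      by (intro sum_mono V3)
    also have "\<dots> \<le> vf + vh" using nonneg by simp
    finally show "expectation (\<lambda>\<omega>. (block_sum f h n \<omega>)\<^sup>2) \<le> vf + vh" .
  qed
qed

text \<open>By independence the characteristic function is a product of an r-th and an (n - r)-th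
  power, one for each block; relative to n the exponents tend to \<open>\<gamma>\<close> and 1 -
  \<open>\<gamma>\<close>, which become the weights of the two second moments.\<close>

lemma char_block_sum_tendsto:
  assumes f: "centred_L2 f" and h: "centred_L2 h"
  shows "(\<lambda>n. char (distr M borel (block_sum f h n)) t) \<longlonglongrightarrow>
    of_real (exp (- ((\<gamma> * expectation (\<lambda>\<omega>. (f (Z 0 \<omega>))\<^sup>2) +
      (1 - \<gamma>) * expectation (\<lambda>\<omega>. (h (Z 0 \<omega>))\<^sup>2)) * t\<^sup>2) / 2))"
proof -
  have [measurable]: "f \<in> borel_measurable N" "h \<in> borel_measurable N"
    using f h by (auto simp: centred_L2_def)
  define \<phi> where "\<phi> u = char (distr M borel (\<lambda>\<omega>. u (Z 0 \<omega>)))" for u :: "'z \<Rightarrow> real"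
  have ch: "char (distr M borel (\<lambda>\<omega>. u (Z i \<omega>) / c)) t = \<phi> u (t / c)"
    if [measurable]: "u \<in> borel_measurable N" for u i c
  proof -
    have "char (distr M borel (\<lambda>\<omega>. u (Z i \<omega>) / c)) t = char (distr (distr M N (Z i)) borel u) (t / c)"
      by (simp add: char_def integral_distr)
    also have "\<dots> = \<phi> u (t / c)"
      unfolding ident_Z[of i] \<phi>_def by (simp add: char_def integral_distr)
    finally show ?thesis .
  qed
  have eq: "char (distr M borel (block_sum f h n)) t =
      \<phi> f (t / sqrt (real n)) ^ r n * \<phi> h (t / sqrt (real n)) ^ (n - r n)" for n
  proof -
    have "char (distr M borel (block_sum f h n)) t =
      (\<Prod>i=1..n. char (distr M borel (\<lambda>\<omega>. (if i \<le> r n then f (Z i \<omega>) else h (Z i \<omega>)) / sqrt (real n))) t)"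
      unfolding block_sum_def[abs_def]
      by (rule char_distr_sum[OF block_sum_indep]) auto
    also have "\<dots> = (\<Prod>i=1..n. if i \<le> r n then \<phi> f (t / sqrt (real n)) else \<phi> h (t / sqrt (real n)))"
      by (intro prod.cong) (auto simp: ch)
    also have "{1..n} \<inter> {i. i \<le> r n} = {1..r n}" "{1..n} \<inter> - {i. i \<le> r n} = {r n<..n}"
      using r_le[of n] by auto
    then have "(\<Prod>i=1..n. if i \<le> r n then \<phi> f (t / sqrt (real n)) else \<phi> h (t / sqrt (real n))) =
      \<phi> f (t / sqrt (real n)) ^ r n * \<phi> h (t / sqrt (real n)) ^ (n - r n)"
      by (simp add: prod.If_cases)
    finally show ?thesis .
  qed
  have lim': "(\<lambda>n. real (n - r n) / real n) \<longlonglongrightarrow> 1 - \<gamma>"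
  proof (rule Lim_transform_eventually)
    show "(\<lambda>n. 1 - real (r n) / real n) \<longlonglongrightarrow> 1 - \<gamma>"
      by (intro tendsto_intros r_lim)
    show "\<forall>\<^sub>F n in sequentially. 1 - real (r n) / real n = real (n - r n) / real n"
      using eventually_gt_at_top[of 0]
      by eventually_elim (simp add: r_le of_nat_diff diff_divide_distrib)
  qed
  have "(\<lambda>n. \<phi> f (t / sqrt (real n)) ^ r n * \<phi> h (t / sqrt (real n)) ^ (n - r n)) \<longlonglongrightarrow>
    of_real (exp (- (\<gamma> * expectation (\<lambda>\<omega>. (f (Z 0 \<omega>))\<^sup>2) * t\<^sup>2) / 2)) *
    of_real (exp (- ((1 - \<gamma>) * expectation (\<lambda>\<omega>. (h (Z 0 \<omega>))\<^sup>2) * t\<^sup>2) / 2))"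
    unfolding \<phi>_def
    by (intro tendsto_mult char_power_tendsto r_lim lim')
      (use f h r_le in \<open>auto simp: centred_L2_def\<close>)
  also have "of_real (exp (- (\<gamma> * expectation (\<lambda>\<omega>. (f (Z 0 \<omega>))\<^sup>2) * t\<^sup>2) / 2)) *
    of_real (exp (- ((1 - \<gamma>) * expectation (\<lambda>\<omega>. (h (Z 0 \<omega>))\<^sup>2) * t\<^sup>2) / 2)) =
    (of_real (exp (- ((\<gamma> * expectation (\<lambda>\<omega>. (f (Z 0 \<omega>))\<^sup>2) +
      (1 - \<gamma>) * expectation (\<lambda>\<omega>. (h (Z 0 \<omega>))\<^sup>2)) * t\<^sup>2) / 2)) :: complex)"
    unfolding of_real_mult[symmetric] exp_add[symmetric]
    by (intro arg_cong[where f=of_real] arg_cong[where f=exp]) (simp add: field_simps)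
  finally show ?thesis unfolding eq .
qed

text \<open>The centred average is 1 / sqrt n times a block sum, and block sums are bounded in
  probability.\<close>

lemma weak_law:
  assumes [measurable]: "f \<in> borel_measurable N" and "integrable M (\<lambda>\<omega>. (f (Z 0 \<omega>))\<^sup>2)"
  shows "tendsto_0_in_prob M (\<lambda>n \<omega>. (\<Sum>i=1..n. f (Z i \<omega>)) / real n - expectation (\<lambda>\<omega>. f (Z 0 \<omega>)))"
proof -
  define m where "m = expectation (\<lambda>\<omega>. f (Z 0 \<omega>))"
  have int: "integrable M (\<lambda>\<omega>. f (Z 0 \<omega>))"
    by (rule square_integrable_imp_integrable[OF _ assms(2)]) simp
  have c: "centred_L2 (\<lambda>z. f z - m)"
    using assms(2) int by (auto simp: centred_L2_def m_def prob_space power2_diff)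
  have "tendsto_0_in_prob M (\<lambda>n \<omega>. block_sum (\<lambda>z. f z - m) (\<lambda>z. f z - m) n \<omega> * (1 / sqrt (real n)))"
  proof (intro tendsto_0_in_prob_mult bounded_in_prob_block_sum c tendsto_0_in_prob_const)
    show "(\<lambda>n. 1 / sqrt (real n)) \<longlonglongrightarrow> 0"
      by (intro tendsto_divide_0[OF tendsto_const] filterlim_at_top_imp_at_infinity
        filterlim_compose[OF sqrt_at_top] filterlim_real_sequentially)
    show "block_sum (\<lambda>z. f z - m) (\<lambda>z. f z - m) n \<in> borel_measurable M" for n
      by (rule borel_measurable_block_sum) auto
  qed simp
  then show ?thesis
  proof (rule tendsto_0_in_prob_cong)
    show "(\<lambda>\<omega>. block_sum (\<lambda>z. f z - m) (\<lambda>z. f z - m) n \<omega> * (1 / sqrt (real n))) \<in> borel_measurable M" for n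
      using borel_measurable_block_sum[of "\<lambda>z. f z - m" "\<lambda>z. f z - m" n] by simp
    show "\<forall>\<^sub>F n in sequentially. \<forall>\<omega>\<in>space M.
      (\<Sum>i=1..n. f (Z i \<omega>)) / real n - expectation (\<lambda>\<omega>. f (Z 0 \<omega>)) =
      block_sum (\<lambda>z. f z - m) (\<lambda>z. f z - m) n \<omega> * (1 / sqrt (real n))"
      using eventually_gt_at_top[of 0]
      by eventually_elim (simp add: block_sum_all m_def sum_subtractf field_simps)
  qed
qed

text \<open>The random denominators are only controlled with high probability, so \<open>T\<close> may take
  arbitrary values where \<open>D\<close> vanishes.\<close>

lemma ratio_limiting_variance:
  fixes T D N' :: "nat \<Rightarrow> 'a \<Rightarrow> real"
  assumes f: "centred_L2 f" and h: "centred_L2 h"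
    and [measurable]: "\<And>n. T n \<in> borel_measurable M" "\<And>n. D n \<in> borel_measurable M"
      "\<And>n. N' n \<in> borel_measurable M"
    and N': "tendsto_0_in_prob M (\<lambda>n \<omega>. N' n \<omega> - block_sum f h n \<omega>)"
    and D: "tendsto_0_in_prob M (\<lambda>n \<omega>. D n \<omega> - p)" and p: "p > 0"
    and T: "\<And>n \<omega>. n > 0 \<Longrightarrow> \<omega> \<in> space M \<Longrightarrow> D n \<omega> \<noteq> 0 \<Longrightarrow> sqrt (real n) * (T n \<omega> - q) = N' n \<omega> / D n \<omega>"
  shows "has_limiting_variance M T q ((\<gamma> * expectation (\<lambda>\<omega>. (f (Z 0 \<omega>))\<^sup>2) +
      (1 - \<gamma>) * expectation (\<lambda>\<omega>. (h (Z 0 \<omega>))\<^sup>2)) / p\<^sup>2)"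
proof -
  have [measurable]: "f \<in> borel_measurable N" "h \<in> borel_measurable N"
    using f h by (auto simp: centred_L2_def)
  note [measurable] = borel_measurable_block_sum
  define S where "S n \<omega> = sqrt (real n) * (T n \<omega> - q)" for n \<omega>
  have [measurable]: "S n \<in> borel_measurable M" for n
    unfolding S_def[abs_def] by measurable
  have bN: "bounded_in_prob M N'"
  proof -
    have "bounded_in_prob M (\<lambda>n \<omega>. (N' n \<omega> - block_sum f h n \<omega>) + block_sum f h n \<omega>)"
      by (intro bounded_in_prob_add tendsto_0_in_prob_imp_bounded N' bounded_in_prob_block_sum f h) auto
    then show ?thesis by simp
  qed
  have R1: "tendsto_0_in_prob M (\<lambda>n \<omega>. S n \<omega> - N' n \<omega> / p)"
  proof (rule tendsto_0_in_probI)
    fix \<epsilon> \<delta> :: real assume "\<epsilon> > 0" "\<delta> > 0"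
    \<comment> \<open>The error is N' / D - N' / p = - N' (D - p) / (D p). On the event D \<ge> p /
      2 the factor 1 / (D p) is at most 2 / p^2, and N' (D - p) is a bounded sequence times a
      vanishing one.\<close>
    have P: "tendsto_0_in_prob M (\<lambda>n \<omega>. (2 / p\<^sup>2) * (N' n \<omega> * (D n \<omega> - p)))"
      by (rule tendsto_0_in_prob_mult[OF bounded_in_prob_const[OF tendsto_const]
        tendsto_0_in_prob_mult[OF bN D]]) auto
    have "p / 2 > 0" "\<delta> / 2 > 0" using p \<open>\<delta> > 0\<close> by auto
    from tendsto_0_in_probD[OF D this] tendsto_0_in_probD[OF P \<open>\<epsilon> > 0\<close> this(2)]
      eventually_gt_at_top[of 0]
    show "\<forall>\<^sub>F n in sequentially. prob {\<omega> \<in> space M. norm (S n \<omega> - N' n \<omega> / p) > \<epsilon>} < \<delta>"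
    proof eventually_elim
      case (elim n)
      show ?case
      proof (rule prob_less_of_subset_Un[OF elim(1,2)])
        have "norm (S n \<omega> - N' n \<omega> / p) \<le> norm ((2 / p\<^sup>2) * (N' n \<omega> * (D n \<omega> - p)))"
          if \<omega>: "\<omega> \<in> space M" and d: "\<not> norm (D n \<omega> - p) > p / 2" for \<omega>
        proof -
          have D: "D n \<omega> \<ge> p / 2" "D n \<omega> > 0" using d p unfolding real_norm_def by linarith+
          have "S n \<omega> - N' n \<omega> / p = - (1 / (D n \<omega> * p)) * (N' n \<omega> * (D n \<omega> - p))"
            using T[OF elim(3) \<omega>] D p unfolding S_def by (simp add: field_simps)
          moreover have "norm (1 / (D n \<omega> * p)) \<le> norm (2 / p\<^sup>2)"
          proof -
            have "1 / (D n \<omega> * p) \<le> 1 / (p / 2 * p)"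
              using D p by (intro divide_left_mono mult_right_mono) auto
            also have "\<dots> = 2 / p\<^sup>2" by (simp add: power2_eq_square)
            finally show ?thesis using D p by simp
          qed
          ultimately show ?thesis
            by (simp only: norm_mult norm_minus_cancel mult_right_mono norm_ge_zero mult_nonneg_nonneg)
        qed
        then show "{\<omega> \<in> space M. norm (S n \<omega> - N' n \<omega> / p) > \<epsilon>} \<subseteq>
          {\<omega> \<in> space M. norm (D n \<omega> - p) > p / 2} \<union>
          {\<omega> \<in> space M. norm ((2 / p\<^sup>2) * (N' n \<omega> * (D n \<omega> - p))) > \<epsilon>}"
          by (fastforce intro: less_le_trans)
      qed auto
    qed
  qed
  have R2: "tendsto_0_in_prob M (\<lambda>n \<omega>. (1 / p) * (N' n \<omega> - block_sum f h n \<omega>))"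
    by (rule tendsto_0_in_prob_mult[OF bounded_in_prob_const[OF tendsto_const] N']) auto
  have R: "tendsto_0_in_prob M (\<lambda>n \<omega>. S n \<omega> - (1 / p) * block_sum f h n \<omega>)"
    using tendsto_0_in_prob_add[OF R1 R2] by (simp add: right_diff_distrib)
  define V where "V = (\<gamma> * expectation (\<lambda>\<omega>. (f (Z 0 \<omega>))\<^sup>2) +
      (1 - \<gamma>) * expectation (\<lambda>\<omega>. (h (Z 0 \<omega>))\<^sup>2)) / p\<^sup>2"
  have V: "V \<ge> 0"
    using \<gamma>_pos \<gamma>_le unfolding V_def by (intro divide_nonneg_nonneg add_nonneg_nonneg mult_nonneg_nonneg) auto
  have "weak_conv_m (\<lambda>n. distr M borel (S n)) (centred_normal V)"
  proof (rule levy_continuity)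
    fix t
    have scale: "char (distr M borel (\<lambda>\<omega>. (1 / p) * block_sum f h n \<omega>)) t =
        char (distr M borel (block_sum f h n)) (t / p)" for n
      by (simp add: char_def integral_distr)
    have "(\<lambda>n. char (distr M borel (\<lambda>\<omega>. (1 / p) * block_sum f h n \<omega> +
        (S n \<omega> - (1 / p) * block_sum f h n \<omega>))) t) \<longlonglongrightarrow> of_real (exp (- (V * t\<^sup>2) / 2))"
    proof (rule char_tendsto_Slutsky[OF R])
      show "(\<lambda>n. char (distr M borel (\<lambda>\<omega>. (1 / p) * block_sum f h n \<omega>)) t) \<longlonglongrightarrow>
        of_real (exp (- (V * t\<^sup>2) / 2))"
        unfolding scale using char_block_sum_tendsto[OF f h, of "t / p"]
        by (simp add: V_def power_divide)
    qed auto
    then show "(\<lambda>n. char (distr M borel (S n)) t) \<longlonglongrightarrow> char (centred_normal V) t"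
      using V by (simp add: char_centred_normal)
  qed (auto intro: real_distribution_centred_normal)
  with V show ?thesis
    unfolding has_limiting_variance_def V_def S_def[abs_def] by simp
qed

end

section \<open>Gradients\<close>

lemma gradient_eq:
  assumes "GDERIV f x :> D"
  shows "gradient f x = D"
  unfolding gradient_def
proof (rule the_equality[where P="\<lambda>D. GDERIV f x :> D", OF assms])
  fix D' assume "GDERIV f x :> D'"
  then have "(\<lambda>h. h \<bullet> D') = (\<lambda>h. h \<bullet> D)"
    using assms unfolding gderiv_def by (rule has_derivative_unique)
  then show "D' = D" by (metis vector_eq_ldot)
qed

text \<open>The derivative is a linear functional on a Euclidean space; its Riesz representative is
  its adjoint evaluated at 1.\<close>

lemma GDERIV_gradient:
  fixes f :: "'b::euclidean_space \<Rightarrow> real"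
  assumes "f differentiable (at x)"
  shows "GDERIV f x :> gradient f x"
proof -
  obtain f' where f': "(f has_derivative f') (at x)"
    using assms by (auto simp: differentiable_def)
  then have "linear f'" by (rule has_derivative_linear)
  then have "f' = (\<lambda>h. h \<bullet> adjoint f' 1)"
    by (simp add: adjoint_works)
  with f' have "GDERIV f x :> adjoint f' 1"
    by (simp add: gderiv_def)
  then show ?thesis using gradient_eq by metis
qed

text \<open>Presents each coordinate of the gradient as a sequential limit of values of
  \<open>f\<close>, which is how the gradient of \<open>g t\<close> inherits measurability in
  t.\<close>

lemma gradient_difference_quotient:
  fixes f :: "'b::euclidean_space \<Rightarrow> real"
  assumes "f differentiable (at x)"
  shows "(\<lambda>n. (f (x + (1 / real (Suc n)) *\<^sub>R b) - f x) * real (Suc n)) \<longlonglongrightarrow> gradient f x \<bullet> b"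
proof -
  have "((\<lambda>s. x + s *\<^sub>R b) has_derivative (\<lambda>s. s *\<^sub>R b)) (at 0)"
    by (auto intro!: derivative_eq_intros)
  moreover have "(f has_derivative (\<lambda>h. h \<bullet> gradient f x)) (at (x + 0 *\<^sub>R b))"
    using GDERIV_gradient[OF assms] by (simp add: gderiv_def)
  ultimately have "((\<lambda>s. f (x + s *\<^sub>R b)) has_derivative (\<lambda>s. (s *\<^sub>R b) \<bullet> gradient f x)) (at 0)"
    by (rule has_derivative_compose)
  then have "((\<lambda>s. f (x + s *\<^sub>R b)) has_field_derivative (gradient f x \<bullet> b)) (at 0)"
    by (simp add: has_field_derivative_def inner_commute mult_commute_abs)
  then have "(\<lambda>s. (f (x + (0 + s) *\<^sub>R b) - f (x + 0 *\<^sub>R b)) / s) \<midarrow>0\<rightarrow> gradient f x \<bullet> b"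
    by (simp only: DERIV_def)
  then have "(\<lambda>s. (f (x + s *\<^sub>R b) - f x) / s) \<midarrow>0\<rightarrow> gradient f x \<bullet> b"
    by simp
  moreover have "filterlim (\<lambda>n. 1 / real (Suc n)) (at 0) sequentially"
    using LIMSEQ_inverse_real_of_nat by (simp add: filterlim_at inverse_eq_divide)
  ultimately have "(\<lambda>n. (f (x + (1 / real (Suc n)) *\<^sub>R b) - f x) / (1 / real (Suc n))) \<longlonglongrightarrow> gradient f x \<bullet> b"
    by (rule filterlim_compose)
  then show ?thesis by simp
qed

text \<open>Mean value inequality on the convex ball for \<open>f\<close> minus its linear part at
  \<open>x\<close>: the derivative of that difference is the oscillation of the gradient, bounded by
  \<open>C\<close>.\<close>

lemma linearization_error:
  fixes f :: "'b::euclidean_space \<Rightarrow> real"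
  assumes diff: "\<And>\<xi>. \<xi> \<in> ball x \<rho> \<Longrightarrow> f differentiable (at \<xi>)"
    and bound: "\<And>\<xi>. \<xi> \<in> ball x \<rho> \<Longrightarrow> norm (gradient f \<xi> - gradient f x) \<le> C"
    and y: "y \<in> ball x \<rho>"
  shows "\<bar>f y - f x - gradient f x \<bullet> (y - x)\<bar> \<le> C * norm (y - x)"
proof -
  have x: "x \<in> ball x \<rho>" using y by (auto intro: le_less_trans[OF zero_le_dist])
  have "norm ((f y - gradient f x \<bullet> y) - (f x - gradient f x \<bullet> x)) \<le> C * norm (y - x)"
  proof (rule differentiable_bound[of "ball x \<rho>" "\<lambda>\<xi>. f \<xi> - gradient f x \<bullet> \<xi>"
        "\<lambda>\<xi> h. h \<bullet> (gradient f \<xi> - gradient f x)"])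
    fix \<xi> assume \<xi>: "\<xi> \<in> ball x \<rho>"
    have "(f has_derivative (\<lambda>h. h \<bullet> gradient f \<xi>)) (at \<xi>)"
      using GDERIV_gradient[OF diff[OF \<xi>]] by (simp add: gderiv_def)
    then have "((\<lambda>\<xi>. f \<xi> - gradient f x \<bullet> \<xi>) has_derivative
        (\<lambda>h. h \<bullet> gradient f \<xi> - gradient f x \<bullet> h)) (at \<xi>)"
      by (intro derivative_intros)
    then show "((\<lambda>\<xi>. f \<xi> - gradient f x \<bullet> \<xi>) has_derivative
        (\<lambda>h. h \<bullet> (gradient f \<xi> - gradient f x))) (at \<xi> within ball x \<rho>)"
      by (auto simp: inner_diff_right inner_commute intro: has_derivative_at_withinI)
    have "\<bar>h \<bullet> (gradient f \<xi> - gradient f x)\<bar> \<le> C * norm h" for h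
    proof -
      have "\<bar>h \<bullet> (gradient f \<xi> - gradient f x)\<bar> \<le> norm h * norm (gradient f \<xi> - gradient f x)"
        by (rule Cauchy_Schwarz_ineq2)
      also have "\<dots> \<le> norm h * C" by (intro mult_left_mono bound[OF \<xi>]) simp
      finally show ?thesis by (simp add: mult.commute)
    qed
    then show "onorm (\<lambda>h. h \<bullet> (gradient f \<xi> - gradient f x)) \<le> C"
      by (intro onorm_le) simp
  qed (use x y in auto)
  then show ?thesis by (simp add: inner_diff_right algebra_simps)
qed

section \<open>The semiparametric model\<close>

locale semiparametric_model =
  labelled_sample M "borel \<Otimes>\<^sub>M borel" "\<lambda>i \<omega>. (X i \<omega>, Y i \<omega>)" r \<gamma>
  for M :: "'a measure" and X :: "nat \<Rightarrow> 'a \<Rightarrow> real^'f" and Y :: "nat \<Rightarrow> 'a \<Rightarrow> real" and r \<gamma> +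
  fixes g :: "real^'f \<Rightarrow> real^'p \<Rightarrow> real" and \<Theta> U :: "(real^'p) set" and \<theta> :: "real^'p"
  assumes Y_01: "\<omega> \<in> space M \<Longrightarrow> Y i \<omega> \<in> {0, 1}"
    and g_measurable: "(\<lambda>(t, \<eta>). g t \<eta>) \<in> borel_measurable (restrict_space borel (UNIV \<times> \<Theta>))"
    and g_bounds: "\<eta> \<in> \<Theta> \<Longrightarrow> 0 < g t \<eta> \<and> g t \<eta> < 1"
    and model: "AE \<omega> in M. real_cond_exp M (vimage_algebra (space M) (X 0) borel)
                  (indicator {\<omega>' \<in> space M. Y 0 \<omega>' = 1}) \<omega> = g (X 0 \<omega>) \<theta>"
    and U: "open U" "\<theta> \<in> U" "U \<subseteq> \<Theta>"
    and g_diff: "\<eta> \<in> U \<Longrightarrow> g t differentiable (at \<eta>)"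
    and g_cont_diff: "continuous_on U (gradient (g t))"
    and g_dom: "(\<integral>\<^sup>+ \<omega>. (SUP \<eta>\<in>U. ennreal (norm (gradient (g (X 0 \<omega>)) \<eta>))) \<partial>M) < \<infinity>"
    and info_integrable: "integrable M (\<lambda>\<omega>. info g (X 0 \<omega>) \<theta>)"
begin

abbreviation "g0 t \<equiv> g t \<theta>"
abbreviation "G t \<equiv> gradient (g t) \<theta>"
abbreviation "w t \<equiv> weight g t \<theta>"

lemma \<theta>_in: "\<theta> \<in> \<Theta>" using U by auto

lemma g0_bounds: "0 < g0 t" "g0 t < 1"
  using g_bounds[OF \<theta>_in] by auto

lemma measurable_X [measurable]: "X i \<in> borel_measurable M"
  using measurable_compose[OF measurable_Z[of i] measurable_fst] by simp

lemma measurable_Y [measurable]: "Y i \<in> borel_measurable M"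
  using measurable_compose[OF measurable_Z[of i] measurable_snd] by simp

text \<open>Joint measurability of \<open>g\<close> is available only over \<open>\<Theta>\<close>,
  so a random parameter has to stay in \<open>\<Theta>\<close> at every point of the space.\<close>

lemma borel_measurable_g:
  assumes [measurable]: "x \<in> borel_measurable L" "e \<in> borel_measurable L"
    and "\<And>\<omega>. \<omega> \<in> space L \<Longrightarrow> e \<omega> \<in> \<Theta>"
  shows "(\<lambda>\<omega>. g (x \<omega>) (e \<omega>)) \<in> borel_measurable L"
proof -
  have "(\<lambda>\<omega>. (x \<omega>, e \<omega>)) \<in> measurable L (restrict_space borel (UNIV \<times> \<Theta>))"
    using assms(3) by (intro measurable_restrict_space2) auto
  from measurable_compose[OF this g_measurable] show ?thesis by simp
qed

lemma borel_measurable_g_param: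
  assumes "\<eta> \<in> \<Theta>"
  shows "(\<lambda>t. g t \<eta>) \<in> borel_measurable borel"
  using assms by (intro borel_measurable_g) auto

lemma measurable_g0 [measurable]: "g0 \<in> borel_measurable borel"
  by (rule borel_measurable_g_param[OF \<theta>_in])

lemma borel_measurable_gradient:
  assumes \<eta>: "\<eta> \<in> U"
  shows "(\<lambda>t. gradient (g t) \<eta>) \<in> borel_measurable borel"
proof (rule borel_measurable_euclidean_space[THEN iffD2], intro ballI)
  fix b :: "real^'p" assume "b \<in> Basis"
  define \<eta>' where "\<eta>' n = \<eta> + (1 / real (Suc n)) *\<^sub>R b" for n
  have "\<eta>' \<longlonglongrightarrow> \<eta> + 0 *\<^sub>R b"
    unfolding \<eta>'_def using LIMSEQ_inverse_real_of_nat
    by (intro tendsto_intros) (simp add: inverse_eq_divide)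
  then have ev: "\<forall>\<^sub>F n in sequentially. \<eta>' n \<in> U"
    using U(1) \<eta> by (simp add: topological_tendstoD)
  show "(\<lambda>t. gradient (g t) \<eta> \<bullet> b) \<in> borel_measurable borel"
  proof (rule borel_measurable_LIMSEQ_real)
    fix t
    \<comment> \<open>The value 0 replaces the quotient while \<open>\<eta>' n\<close> is outside
      \<open>U\<close>, where nothing guarantees measurability of \<open>g\<close>. Since
      \<open>U\<close> is open this affects finitely many n.\<close>
    show "(\<lambda>n. if \<eta>' n \<in> U then (g t (\<eta>' n) - g t \<eta>) * real (Suc n) else 0) \<longlonglongrightarrow> gradient (g t) \<eta> \<bullet> b"
    proof (rule Lim_transform_eventually)
      show "(\<lambda>n. (g t (\<eta>' n) - g t \<eta>) * real (Suc n)) \<longlonglongrightarrow> gradient (g t) \<eta> \<bullet> b"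
        unfolding \<eta>'_def by (rule gradient_difference_quotient[OF g_diff[OF \<eta>]])
      show "\<forall>\<^sub>F n in sequentially. (g t (\<eta>' n) - g t \<eta>) * real (Suc n) =
          (if \<eta>' n \<in> U then (g t (\<eta>' n) - g t \<eta>) * real (Suc n) else 0)"
        using ev by eventually_elim simp
    qed
  next
    fix n
    have [measurable]: "(\<lambda>t. g t \<eta>) \<in> borel_measurable borel"
      using \<eta> U by (intro borel_measurable_g_param) auto
    show "(\<lambda>t. if \<eta>' n \<in> U then (g t (\<eta>' n) - g t \<eta>) * real (Suc n) else 0) \<in> borel_measurable borel"
    proof (cases "\<eta>' n \<in> U")
      case True
      then have [measurable]: "(\<lambda>t. g t (\<eta>' n)) \<in> borel_measurable borel"
        using U by (intro borel_measurable_g_param) auto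
      show ?thesis using True by simp
    qed simp
  qed
qed

lemma measurable_G [measurable]: "G \<in> borel_measurable borel"
  by (rule borel_measurable_gradient[OF U(2)])

lemma measurable_w [measurable]: "w \<in> borel_measurable borel"
  unfolding weight_def by measurable

lemma w_pos: "w t > 0"
  using g0_bounds[of t] by (simp add: weight_def)

lemma w_mult: "w t * (g0 t * (1 - g0 t)) = 1"
  using g0_bounds[of t] by (simp add: weight_def)

text \<open>Makes the unweighted second moment of \<open>G\<close> finite as soon as the weighted
  one, a quadratic form of the information, is.\<close>

lemma w_ge_1: "1 \<le> w t"
proof -
  have "g0 t * (1 - g0 t) \<le> 1 * 1"
    using g0_bounds[of t] by (intro mult_mono) auto
  then show ?thesis using g0_bounds[of t] by (simp add: weight_def)
qed

text \<open>The model assumption in the form \<open>E f(X) Q = E f(X) u(X)\<close>, where \<open>Q\<close> is \<open>Y\<close> or \<open>1 - Y\<close>.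
  The score is a product of the unbounded weight with a residual, so its moments can only be split
  according to the value of \<open>Y\<close>.\<close>

lemma expectation_mult_response:
  fixes f u :: "real^'f \<Rightarrow> real"
  assumes Q: "Q = Y 0 \<and> u = g0 \<or> Q = (\<lambda>\<omega>. 1 - Y 0 \<omega>) \<and> u = (\<lambda>t. 1 - g0 t)"
    and [measurable]: "f \<in> borel_measurable borel"
    and int: "integrable M (\<lambda>\<omega>. f (X 0 \<omega>) * u (X 0 \<omega>))"
  shows "integrable M (\<lambda>\<omega>. f (X 0 \<omega>) * Q \<omega>)"
    and "expectation (\<lambda>\<omega>. f (X 0 \<omega>) * Q \<omega>) = expectation (\<lambda>\<omega>. f (X 0 \<omega>) * u (X 0 \<omega>))"
proof -
  let ?F = "vimage_algebra (space M) (X 0) borel"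
  have sub: "subalgebra M ?F"
    unfolding subalgebra_def using measurable_X[of 0]
    by (auto simp: sets_vimage_algebra2 measurable_sets)
  interpret F: finite_measure_subalgebra M ?F
    by unfold_locales (rule sub)
  have [measurable]: "u \<in> borel_measurable borel" using Q by auto
  have fX: "(\<lambda>\<omega>. h (X 0 \<omega>)) \<in> borel_measurable ?F" if "h \<in> borel_measurable borel" for h :: "real^'f \<Rightarrow> 'c::topological_space"
    by (rule measurable_compose[OF measurable_vimage_algebra1 that]) auto
  define J where "J = (indicator {\<omega> \<in> space M. Y 0 \<omega> = 1} :: 'a \<Rightarrow> real)"
  have J: "\<And>\<omega>. \<omega> \<in> space M \<Longrightarrow> J \<omega> = Y 0 \<omega>"
    using Y_01[of _ 0] by (auto simp: J_def indicator_def)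
  have [measurable]: "J \<in> borel_measurable M" unfolding J_def by measurable
  have [measurable]: "Q \<in> borel_measurable M" using Q by auto
  have Q01: "0 \<le> Q \<omega>" "Q \<omega> \<le> 1" if "\<omega> \<in> space M" for \<omega> using Q Y_01[OF that, of 0] by auto
  have intJ: "integrable M J"
    by (rule integrable_const_bound[where B=1]) (auto simp: J_def)
  have intQ: "integrable M Q"
    by (rule integrable_const_bound[where B=1]) (auto simp: Q01 abs_le_iff intro: order_trans[OF _ Q01(1)])
  have condQ: "AE \<omega> in M. real_cond_exp M ?F Q \<omega> = u (X 0 \<omega>)"
    using Q
  proof
    assume "Q = Y 0 \<and> u = g0"
    moreover have "AE \<omega> in M. real_cond_exp M ?F J \<omega> = real_cond_exp M ?F (Y 0) \<omega>"
      by (rule F.real_cond_exp_cong) (auto simp: J)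
    ultimately show ?thesis using model by (auto simp: J_def)
  next
    assume Q: "Q = (\<lambda>\<omega>. 1 - Y 0 \<omega>) \<and> u = (\<lambda>t. 1 - g0 t)"
    have "AE \<omega> in M. real_cond_exp M ?F (\<lambda>\<omega>. 1 - J \<omega>) \<omega> = real_cond_exp M ?F Q \<omega>"
      using Q by (intro F.real_cond_exp_cong) (auto simp: J)
    moreover have "AE \<omega> in M. real_cond_exp M ?F (\<lambda>\<omega>. 1 - J \<omega>) \<omega> =
        real_cond_exp M ?F (\<lambda>\<omega>. 1) \<omega> - real_cond_exp M ?F J \<omega>"
      by (rule F.real_cond_exp_diff) (auto simp: intJ)
    moreover have "AE \<omega> in M. real_cond_exp M ?F (\<lambda>\<omega>. 1) \<omega> = 1"
      by (rule F.real_cond_exp_F_meas) auto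
    ultimately show ?thesis
      using model[folded J_def] by eventually_elim (use Q in simp)
  qed
  \<comment> \<open>Integrability of f(X) Q is part of the claim, so the defining property of the
    real conditional expectation cannot be used yet. The version for nonnegative functions needs no
    integrability; it is recovered here after checking that it is finite almost everywhere, so that
    \<open>enn2real\<close> loses nothing.\<close>
  have nnQ: "AE \<omega> in M. nn_cond_exp M ?F (\<lambda>\<omega>. ennreal (Q \<omega>)) \<omega> = ennreal (u (X 0 \<omega>))"
  proof -
    have "(\<integral>\<^sup>+\<omega>. 1 * nn_cond_exp M ?F (\<lambda>\<omega>. ennreal (Q \<omega>)) \<omega> \<partial>M) = (\<integral>\<^sup>+\<omega>. 1 * ennreal (Q \<omega>) \<partial>M)"
      by (rule F.nn_cond_exp_intg) auto
    also have "\<dots> < \<infinity>"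
      using nn_integral_eq_integral[OF intQ] by (simp add: Q01)
    finally have "AE \<omega> in M. nn_cond_exp M ?F (\<lambda>\<omega>. ennreal (Q \<omega>)) \<omega> \<noteq> \<infinity>"
      by (intro nn_integral_PInf_AE) auto
    moreover have "AE \<omega> in M. nn_cond_exp M ?F (\<lambda>\<omega>. ennreal (- Q \<omega>)) \<omega> = nn_cond_exp M ?F (\<lambda>\<omega>. 0) \<omega>"
      by (rule F.nn_cond_exp_cong) (auto simp: Q01 ennreal_neg)
    moreover have "AE \<omega> in M. 0 = nn_cond_exp M ?F (\<lambda>\<omega>. 0) \<omega>"
      using F.nn_cond_exp_F_meas[of "\<lambda>_. 0"] by auto
    ultimately show ?thesis
      using condQ
    proof eventually_elim
      case (elim \<omega>)
      then have "u (X 0 \<omega>) = enn2real (nn_cond_exp M ?F (\<lambda>\<omega>. ennreal (Q \<omega>)) \<omega>)"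
        by (simp add: real_cond_exp_def)
      with elim show ?case by (simp add: less_top)
    qed
  qed
  have u0: "u t \<ge> 0" for t using Q g0_bounds[of t] by auto
  have "(\<integral>\<^sup>+\<omega>. ennreal \<bar>f (X 0 \<omega>)\<bar> * ennreal (Q \<omega>) \<partial>M) =
    (\<integral>\<^sup>+\<omega>. ennreal \<bar>f (X 0 \<omega>)\<bar> * nn_cond_exp M ?F (\<lambda>\<omega>. ennreal (Q \<omega>)) \<omega> \<partial>M)"
    by (rule F.nn_cond_exp_intg[symmetric]) (auto intro!: fX)
  also have "\<dots> = (\<integral>\<^sup>+\<omega>. ennreal (norm (f (X 0 \<omega>) * u (X 0 \<omega>))) \<partial>M)"
    using nnQ by (intro nn_integral_cong_AE) (auto simp: abs_mult ennreal_mult u0)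
  also have "\<dots> < \<infinity>"
    using int by (simp add: integrable_iff_bounded)
  also have "(\<integral>\<^sup>+\<omega>. ennreal \<bar>f (X 0 \<omega>)\<bar> * ennreal (Q \<omega>) \<partial>M) =
      (\<integral>\<^sup>+\<omega>. ennreal (norm (f (X 0 \<omega>) * Q \<omega>)) \<partial>M)"
    by (intro nn_integral_cong) (simp add: abs_mult ennreal_mult Q01)
  finally show fQ: "integrable M (\<lambda>\<omega>. f (X 0 \<omega>) * Q \<omega>)"
    by (intro integrableI_bounded) auto
  have "expectation (\<lambda>\<omega>. f (X 0 \<omega>) * Q \<omega>) = expectation (\<lambda>\<omega>. f (X 0 \<omega>) * real_cond_exp M ?F Q \<omega>)"
    by (rule F.real_cond_exp_intg(2)[symmetric, OF fQ]) (auto intro!: fX)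
  also have "\<dots> = expectation (\<lambda>\<omega>. f (X 0 \<omega>) * u (X 0 \<omega>))"
    using condQ by (intro integral_cong_AE) auto
  finally show "expectation (\<lambda>\<omega>. f (X 0 \<omega>) * Q \<omega>) = expectation (\<lambda>\<omega>. f (X 0 \<omega>) * u (X 0 \<omega>))" .
qed

text \<open>As Y is 0 or 1, f(X, Y) = f(X, 1) Y + f(X, 0) (1 - Y). The integrability conditions
  carry the factors g and 1 - g, which compensate the growth of the weight where g is close to 0 or
  1.\<close>

lemma integral_model:
  fixes f :: "(real^'f) \<times> real \<Rightarrow> real"
  assumes [measurable]: "f \<in> borel_measurable (borel \<Otimes>\<^sub>M borel)"
    and i1: "integrable M (\<lambda>\<omega>. f (X 0 \<omega>, 1) * g0 (X 0 \<omega>))"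
    and i0: "integrable M (\<lambda>\<omega>. f (X 0 \<omega>, 0) * (1 - g0 (X 0 \<omega>)))"
  shows "integrable M (\<lambda>\<omega>. f (X 0 \<omega>, Y 0 \<omega>))"
    and "expectation (\<lambda>\<omega>. f (X 0 \<omega>, Y 0 \<omega>)) =
      expectation (\<lambda>\<omega>. f (X 0 \<omega>, 1) * g0 (X 0 \<omega>) + f (X 0 \<omega>, 0) * (1 - g0 (X 0 \<omega>)))"
proof -
  have eq: "f (X 0 \<omega>, Y 0 \<omega>) = f (X 0 \<omega>, 1) * Y 0 \<omega> + f (X 0 \<omega>, 0) * (1 - Y 0 \<omega>)"
    if "\<omega> \<in> space M" for \<omega> using Y_01[OF that, of 0] by auto
  note 1 = expectation_mult_response[OF disjI1, OF conjI[OF refl refl] _ i1]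
  note 0 = expectation_mult_response[OF disjI2, OF conjI[OF refl refl] _ i0]
  have m: "(\<lambda>t. f (t, c)) \<in> borel_measurable borel" for c by measurable
  have int: "integrable M (\<lambda>\<omega>. f (X 0 \<omega>, 1) * Y 0 \<omega> + f (X 0 \<omega>, 0) * (1 - Y 0 \<omega>))"
    using 1(1)[OF m] 0(1)[OF m] by simp
  then show "integrable M (\<lambda>\<omega>. f (X 0 \<omega>, Y 0 \<omega>))"
    by (subst Bochner_Integration.integrable_cong[OF refl eq])
  have "expectation (\<lambda>\<omega>. f (X 0 \<omega>, Y 0 \<omega>)) =
      expectation (\<lambda>\<omega>. f (X 0 \<omega>, 1) * Y 0 \<omega> + f (X 0 \<omega>, 0) * (1 - Y 0 \<omega>))"
    by (rule Bochner_Integration.integral_cong[OF refl eq])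
  also have "\<dots> = expectation (\<lambda>\<omega>. f (X 0 \<omega>, 1) * g0 (X 0 \<omega>) + f (X 0 \<omega>, 0) * (1 - g0 (X 0 \<omega>)))"
    using 1[OF m] 0[OF m] i1 i0 by simp
  finally show "expectation (\<lambda>\<omega>. f (X 0 \<omega>, Y 0 \<omega>)) =
      expectation (\<lambda>\<omega>. f (X 0 \<omega>, 1) * g0 (X 0 \<omega>) + f (X 0 \<omega>, 0) * (1 - g0 (X 0 \<omega>)))" .
qed

section \<open>The information matrix and the moments of the score\<close>

definition A :: "real^'p^'p" where "A = expectation (\<lambda>\<omega>. info g (X 0 \<omega>) \<theta>)"

lemma quadratic_info: "d \<bullet> (info g t \<theta> *v d) = w t * (G t \<bullet> d)\<^sup>2"
proof -
  have "(info g t \<theta> *v d) = (w t * (G t \<bullet> d)) *\<^sub>R G t"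
    by (simp add: info_def vec_eq_iff matrix_vector_mult_def inner_vec_def sum_distrib_left sum_distrib_right mult_ac)
  then show ?thesis by (simp add: power2_eq_square inner_commute mult_ac)
qed

text \<open>The quadratic form is a bounded linear functional of the matrix, so it commutes with the
  matrix-valued integral defining \<open>A\<close>.\<close>

lemma
  shows integrable_quadratic_info: "integrable M (\<lambda>\<omega>. w (X 0 \<omega>) * (G (X 0 \<omega>) \<bullet> d)\<^sup>2)"
    and expectation_quadratic_info: "expectation (\<lambda>\<omega>. w (X 0 \<omega>) * (G (X 0 \<omega>) \<bullet> d)\<^sup>2) = d \<bullet> (A *v d)"
proof -
  have "linear (\<lambda>B::real^'p^'p. d \<bullet> (B *v d))"
    by (rule linearI) (simp_all add: matrix_vector_mult_add_rdistrib inner_add_right scaleR_matrix_vector_assoc[symmetric])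
  then have bl: "bounded_linear (\<lambda>B::real^'p^'p. d \<bullet> (B *v d))"
    by (rule linear_conv_bounded_linear[THEN iffD1])
  show "integrable M (\<lambda>\<omega>. w (X 0 \<omega>) * (G (X 0 \<omega>) \<bullet> d)\<^sup>2)"
    using integrable_bounded_linear[OF bl info_integrable] by (simp add: quadratic_info)
  show "expectation (\<lambda>\<omega>. w (X 0 \<omega>) * (G (X 0 \<omega>) \<bullet> d)\<^sup>2) = d \<bullet> (A *v d)"
    using integral_bounded_linear[OF bl info_integrable] by (simp add: quadratic_info A_def)
qed

lemma square_integrable_G: "integrable M (\<lambda>\<omega>. (G (X 0 \<omega>) \<bullet> d)\<^sup>2)"
proof (rule Bochner_Integration.integrable_bound[OF integrable_quadratic_info[of d]])
  have "(G t \<bullet> d)\<^sup>2 \<le> w t * (G t \<bullet> d)\<^sup>2" for t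
    using mult_right_mono[OF w_ge_1, of "(G t \<bullet> d)\<^sup>2" t] by simp
  then show "AE \<omega> in M. norm ((G (X 0 \<omega>) \<bullet> d)\<^sup>2) \<le> norm (w (X 0 \<omega>) * (G (X 0 \<omega>) \<bullet> d)\<^sup>2)"
    using w_pos by (simp add: abs_mult less_imp_le)
qed measurable

lemma integrable_G: "integrable M (\<lambda>\<omega>. G (X 0 \<omega>) \<bullet> d)"
  by (rule square_integrable_imp_integrable[OF _ square_integrable_G]) measurable

lemma integrable_bounded_mult:
  fixes \<phi> :: "real^'f \<Rightarrow> real"
  assumes [measurable]: "\<phi> \<in> borel_measurable borel" and "\<And>t. \<bar>\<phi> t\<bar> \<le> C"
    and f: "integrable M f"
  shows "integrable M (\<lambda>\<omega>. \<phi> (X 0 \<omega>) * f \<omega>)"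
proof (rule Bochner_Integration.integrable_bound[of M "\<lambda>\<omega>. C * f \<omega>"])
  have [measurable]: "f \<in> borel_measurable M" using f by simp
  show "(\<lambda>\<omega>. \<phi> (X 0 \<omega>) * f \<omega>) \<in> borel_measurable M" by measurable
  show "AE \<omega> in M. norm (\<phi> (X 0 \<omega>) * f \<omega>) \<le> norm (C * f \<omega>)"
    by (intro AE_I2) (auto simp: abs_mult intro!: mult_right_mono order_trans[OF assms(2)])
qed (use f in simp)

text \<open>Coordinates in a fixed direction reduce the vector-valued score to the real summands
  that \<open>block_sum\<close> accepts.\<close>

definition score_along :: "real^'p \<Rightarrow> (real^'f) \<times> real \<Rightarrow> real" where
  "score_along d z = score g (fst z) (snd z) \<theta> \<bullet> d"

lemma score_along_eq: "score_along d (t, y) = w t * (y - g0 t) * (G t \<bullet> d)"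
  by (simp add: score_along_def score_def)

lemma measurable_score_along [measurable]: "score_along d \<in> borel_measurable (borel \<Otimes>\<^sub>M borel)"
  unfolding score_along_def[abs_def] score_def by measurable

text \<open>Conditionally on X the contributions of Y = 1 and Y = 0 are opposite, because w g (1 -
  g) = 1 removes the weight from both. The case \<open>\<phi>\<close> = 1 centres the score; the
  general case kills the cross term in the variance of \<open>q_hat\<close>.\<close>

lemma score_along_uncorrelated:
  assumes [measurable]: "\<phi> \<in> borel_measurable borel" and "\<And>t. \<bar>\<phi> t\<bar> \<le> C"
  shows "integrable M (\<lambda>\<omega>. \<phi> (X 0 \<omega>) * score_along d (X 0 \<omega>, Y 0 \<omega>))"
    and "expectation (\<lambda>\<omega>. \<phi> (X 0 \<omega>) * score_along d (X 0 \<omega>, Y 0 \<omega>)) = 0"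
proof -
  have m: "(\<lambda>z. \<phi> (fst z) * score_along d z) \<in> borel_measurable (borel \<Otimes>\<^sub>M borel)" by measurable
  have 1: "\<phi> t * score_along d (t, 1) * g0 t = \<phi> t * (G t \<bullet> d)" for t
  proof -
    have "\<phi> t * score_along d (t, 1) * g0 t = \<phi> t * (w t * (g0 t * (1 - g0 t))) * (G t \<bullet> d)"
      unfolding score_along_eq by (simp add: mult_ac)
    then show ?thesis by (simp add: w_mult)
  qed
  have 0: "\<phi> t * score_along d (t, 0) * (1 - g0 t) = - (\<phi> t * (G t \<bullet> d))" for t
  proof -
    have "\<phi> t * score_along d (t, 0) * (1 - g0 t) = - (\<phi> t * (w t * (g0 t * (1 - g0 t))) * (G t \<bullet> d))"
      unfolding score_along_eq by (simp add: mult_ac)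
    then show ?thesis by (simp add: w_mult)
  qed
  note int = integrable_bounded_mult[OF assms integrable_G[of d]]
  show "integrable M (\<lambda>\<omega>. \<phi> (X 0 \<omega>) * score_along d (X 0 \<omega>, Y 0 \<omega>))"
    "expectation (\<lambda>\<omega>. \<phi> (X 0 \<omega>) * score_along d (X 0 \<omega>, Y 0 \<omega>)) = 0"
    using integral_model[OF m] int by (simp_all add: 0 1)
qed

text \<open>The conditional variance of Y given X is 1 / w, which cancels one of the two factors w
  of the squared score. The two values of Y contribute the shares 1 - g and g of the
  information.\<close>

lemma
  shows integrable_score_along_square: "integrable M (\<lambda>\<omega>. (score_along d (X 0 \<omega>, Y 0 \<omega>))\<^sup>2)"
    and expectation_score_along_square: "expectation (\<lambda>\<omega>. (score_along d (X 0 \<omega>, Y 0 \<omega>))\<^sup>2) = d \<bullet> (A *v d)"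
proof -
  have m: "(\<lambda>z. (score_along d z)\<^sup>2) \<in> borel_measurable (borel \<Otimes>\<^sub>M borel)" by measurable
  have 1: "(score_along d (t, 1))\<^sup>2 * g0 t = (1 - g0 t) * (w t * (G t \<bullet> d)\<^sup>2)" for t
  proof -
    have "(score_along d (t, 1))\<^sup>2 * g0 t = (w t * (g0 t * (1 - g0 t))) * ((1 - g0 t) * (w t * (G t \<bullet> d)\<^sup>2))"
      unfolding score_along_eq by (simp add: mult_ac power2_eq_square)
    then show ?thesis by (simp add: w_mult)
  qed
  have 0: "(score_along d (t, 0))\<^sup>2 * (1 - g0 t) = g0 t * (w t * (G t \<bullet> d)\<^sup>2)" for t
  proof -
    have "(score_along d (t, 0))\<^sup>2 * (1 - g0 t) = (w t * (g0 t * (1 - g0 t))) * (g0 t * (w t * (G t \<bullet> d)\<^sup>2))"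
      unfolding score_along_eq by (simp add: mult_ac power2_eq_square)
    then show ?thesis by (simp add: w_mult)
  qed
  have i0: "integrable M (\<lambda>\<omega>. g0 (X 0 \<omega>) * (w (X 0 \<omega>) * (G (X 0 \<omega>) \<bullet> d)\<^sup>2))"
    using g0_bounds by (intro integrable_bounded_mult[where C=1] integrable_quadratic_info) (auto simp: abs_le_iff less_imp_le intro: order_trans[of _ 0])
  have i1: "integrable M (\<lambda>\<omega>. (1 - g0 (X 0 \<omega>)) * (w (X 0 \<omega>) * (G (X 0 \<omega>) \<bullet> d)\<^sup>2))"
    using i0 integrable_quadratic_info[of d] by (simp add: left_diff_distrib)
  note * = integral_model[OF m, unfolded 0 1, OF i1 i0]
  show "integrable M (\<lambda>\<omega>. (score_along d (X 0 \<omega>, Y 0 \<omega>))\<^sup>2)" by (rule *(1))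
  show "expectation (\<lambda>\<omega>. (score_along d (X 0 \<omega>, Y 0 \<omega>))\<^sup>2) = d \<bullet> (A *v d)"
    unfolding *(2) expectation_quadratic_info[symmetric] by (simp add: algebra_simps)
qed

lemma centred_L2_score_along: "centred_L2 (score_along d)"
  using score_along_uncorrelated(2)[of "\<lambda>_. 1" 1 d] integrable_score_along_square[of d]
  by (simp add: centred_L2_def)

end

section \<open>Modulus of continuity of the gradient near the true parameter\<close>

context semiparametric_model
begin

text \<open>The modulus \<open>m\<close> is a supremum over a countable dense set of
  parameters, which keeps it measurable; its mean vanishes as the ball shrinks, by dominated
  convergence.\<close>

lemma ex_gradient_modulus:
  assumes "\<epsilon> > 0"
  obtains \<rho> m where "\<rho> > 0" "ball \<theta> \<rho> \<subseteq> U" "m \<in> borel_measurable borel"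
    "\<And>t \<eta>. \<eta> \<in> ball \<theta> \<rho> \<Longrightarrow> ennreal (norm (gradient (g t) \<eta> - G t)) \<le> m t"
    "(\<integral>\<^sup>+\<omega>. m (X 0 \<omega>) \<partial>M) < ennreal \<epsilon>"
proof -
  obtain \<rho>0 where \<rho>0: "\<rho>0 > 0" "ball \<theta> \<rho>0 \<subseteq> U"
    using U open_contains_ball by blast
  define \<rho> where "\<rho> k = \<rho>0 / real (Suc k)" for k
  have \<rho>: "\<rho> k > 0" "\<rho> k \<le> \<rho>0" for k
    using \<rho>0 by (auto simp: \<rho>_def divide_le_eq mult_le_cancel_left1)
  then have ball: "ball \<theta> (\<rho> k) \<subseteq> U" for k
    using \<rho>0 subset_ball by (blast intro: order_trans)
  obtain D :: "(real^'p) set" where D: "countable D" "\<And>S. open S \<Longrightarrow> S \<noteq> {} \<Longrightarrow> \<exists>d\<in>D. d \<in> S"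
    using countable_dense_setE by blast
  define osc where "osc t \<eta> = ennreal (norm (gradient (g t) \<eta> - G t))" for t \<eta>
  define m where "m k t = (SUP \<eta>\<in>D \<inter> ball \<theta> (\<rho> k). osc t \<eta>)" for k t
  \<comment> \<open>A measurable stand-in for the supremum over \<open>U\<close> in the domination
    hypothesis, whose measurability is not known.\<close>
  define b where "b t = (SUP \<eta>\<in>D \<inter> ball \<theta> \<rho>0. ennreal (norm (gradient (g t) \<eta>)))" for t
  let ?B = "\<lambda>t. SUP \<eta>\<in>U. ennreal (norm (gradient (g t) \<eta>))"
  have meas [measurable]: "(\<lambda>t. gradient (g t) \<eta>) \<in> borel_measurable borel" if "\<eta> \<in> ball \<theta> \<rho>0" for \<eta>
    using that \<rho>0 by (intro borel_measurable_gradient) auto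
  have sub: "ball \<theta> (\<rho> k) \<subseteq> ball \<theta> \<rho>0" for k using \<rho> by (intro subset_ball)
  have m_meas [measurable]: "m k \<in> borel_measurable borel" for k
    unfolding m_def[abs_def] osc_def using D(1) sub[of k]
    by (intro borel_measurable_SUP) (auto intro!: measurable_compose[OF _ measurable_ennreal] borel_measurable_norm borel_measurable_diff meas)
  have b_meas [measurable]: "b \<in> borel_measurable borel"
    unfolding b_def[abs_def] using D(1)
    by (intro borel_measurable_SUP) (auto intro!: measurable_compose[OF _ measurable_ennreal] borel_measurable_norm meas)
  have cont: "continuous_on (ball \<theta> (\<rho> k)) (osc t)" for k t
    unfolding osc_def
    by (intro continuous_intros continuous_on_ennreal continuous_on_subset[OF g_cont_diff ball])
  \<comment> \<open>Within the ball the set where the oscillation exceeds \<open>m k t\<close> is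
    open by continuity; if nonempty it would meet the dense set \<open>D\<close>, over which the
    supremum is taken.\<close>
  have osc_le: "osc t \<eta> \<le> m k t" if \<eta>: "\<eta> \<in> ball \<theta> (\<rho> k)" for t \<eta> k
  proof (rule ccontr)
    assume "\<not> osc t \<eta> \<le> m k t"
    then have "\<eta> \<in> osc t -` {m k t<..} \<inter> ball \<theta> (\<rho> k)" using \<eta> by simp
    moreover have "open (osc t -` {m k t<..} \<inter> ball \<theta> (\<rho> k))"
      using cont[of k t] by (simp add: continuous_on_open_vimage)
    ultimately obtain d where d: "d \<in> D" "d \<in> ball \<theta> (\<rho> k)" "osc t d > m k t"
      using D(2) by blast
    then have "osc t d \<le> m k t" unfolding m_def by (intro SUP_upper) auto
    with d(3) show False by simp
  qed
  have lim: "(\<lambda>k. m k t) \<longlonglongrightarrow> 0" for t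
  proof (rule order_tendstoI)
    fix e :: ennreal assume "0 < e"
    have "continuous_on (ball \<theta> \<rho>0) (osc t)" using cont[of 0 t] by (simp add: \<rho>_def)
    \<comment> \<open>A supremum of values below e' is only known to be \<le> e'; the gap to
      \<open>e\<close> restores strictness.\<close>
    obtain e' where e': "0 < e'" "e' < e" using \<open>0 < e\<close> dense by blast
    have "open (osc t -` {..<e'} \<inter> ball \<theta> \<rho>0)"
      using \<open>continuous_on (ball \<theta> \<rho>0) (osc t)\<close> by (simp add: continuous_on_open_vimage)
    moreover have "\<theta> \<in> osc t -` {..<e'} \<inter> ball \<theta> \<rho>0" using e' \<rho>0 by (simp add: osc_def)
    ultimately obtain s where s: "s > 0" "ball \<theta> s \<subseteq> osc t -` {..<e'} \<inter> ball \<theta> \<rho>0"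
      using open_contains_ball by blast
    have "\<rho> \<longlonglongrightarrow> 0"
      unfolding \<rho>_def using tendsto_mult[OF tendsto_const[of \<rho>0] LIMSEQ_inverse_real_of_nat]
      by (simp add: divide_inverse)
    then have "\<forall>\<^sub>F k in sequentially. \<rho> k < s" using s(1) by (rule order_tendstoD)
    then show "\<forall>\<^sub>F k in sequentially. m k t < e"
    proof eventually_elim
      case (elim k)
      have "m k t \<le> e'"
        unfolding m_def
      proof (rule SUP_least)
        fix \<eta> assume "\<eta> \<in> D \<inter> ball \<theta> (\<rho> k)"
        then have "\<eta> \<in> ball \<theta> s" using elim by auto
        with s show "osc t \<eta> \<le> e'" by (auto intro: less_imp_le)
      qed
      with e' show ?case by simp
    qed
  qed simp
  have bound: "m k t \<le> b t + ennreal (norm (G t))" for k t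
    unfolding m_def
  proof (rule SUP_least)
    fix \<eta> assume \<eta>: "\<eta> \<in> D \<inter> ball \<theta> (\<rho> k)"
    have "osc t \<eta> \<le> ennreal (norm (gradient (g t) \<eta>)) + ennreal (norm (G t))"
      unfolding osc_def
      by (simp add: ennreal_plus[symmetric] norm_triangle_ineq4 ennreal_leI del: ennreal_plus)
    also have "ennreal (norm (gradient (g t) \<eta>)) \<le> b t"
      unfolding b_def using \<eta> sub[of k] by (intro SUP_upper) auto
    finally show "osc t \<eta> \<le> b t + ennreal (norm (G t))" by (simp add: add_right_mono)
  qed
  have "(\<lambda>k. \<integral>\<^sup>+\<omega>. m k (X 0 \<omega>) \<partial>M) \<longlonglongrightarrow> (\<integral>\<^sup>+\<omega>. 0 \<partial>M)"
  proof (rule nn_integral_dominated_convergence[where w="\<lambda>\<omega>. b (X 0 \<omega>) + ennreal (norm (G (X 0 \<omega>)))"])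
    have "(\<integral>\<^sup>+\<omega>. b (X 0 \<omega>) + ennreal (norm (G (X 0 \<omega>))) \<partial>M) =
        (\<integral>\<^sup>+\<omega>. b (X 0 \<omega>) \<partial>M) + (\<integral>\<^sup>+\<omega>. ennreal (norm (G (X 0 \<omega>))) \<partial>M)"
      by (rule nn_integral_add) auto
    also have "\<dots> \<le> (\<integral>\<^sup>+\<omega>. ?B (X 0 \<omega>) \<partial>M) + (\<integral>\<^sup>+\<omega>. ?B (X 0 \<omega>) \<partial>M)"
      using \<rho>0 U(2) by (intro add_mono nn_integral_mono) (auto simp: b_def intro!: SUP_subset_mono SUP_upper)
    also have "\<dots> < \<infinity>" using g_dom by simp
    finally show "(\<integral>\<^sup>+\<omega>. b (X 0 \<omega>) + ennreal (norm (G (X 0 \<omega>))) \<partial>M) < \<infinity>" .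
  qed (auto simp: bound lim)
  then have "\<forall>\<^sub>F k in sequentially. (\<integral>\<^sup>+\<omega>. m k (X 0 \<omega>) \<partial>M) < ennreal \<epsilon>"
    using assms by (intro order_tendstoD(2)) auto
  then obtain k where k: "(\<integral>\<^sup>+\<omega>. m k (X 0 \<omega>) \<partial>M) < ennreal \<epsilon>"
    by (auto simp: eventually_sequentially)
  show ?thesis
    by (rule that[of "\<rho> k" "m k"]) (use \<rho> ball k osc_le in \<open>auto simp: osc_def\<close>)
qed

end

lemma matrix_inv_mult_vec:
  fixes A :: "real^'n^'n"
  assumes "invertible A"
  shows "matrix_inv A *v (A *v x) = x"
proof -
  have "matrix_inv A ** A = mat 1"
    using assms unfolding invertible_def matrix_inv_def by (rule someI2_ex) simp
  then show ?thesis by (simp add: matrix_vector_mul_assoc)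
qed

section \<open>The weighted least squares estimator\<close>

locale weighted_least_squares = semiparametric_model M X Y r \<gamma> g \<Theta> U \<theta>
  for M :: "'a measure" and X :: "nat \<Rightarrow> 'a \<Rightarrow> real^'f" and Y :: "nat \<Rightarrow> 'a \<Rightarrow> real" and r \<gamma>
    and g :: "real^'f \<Rightarrow> real^'p \<Rightarrow> real" and \<Theta> U :: "(real^'p) set" and \<theta> +
  fixes \<theta>hat :: "nat \<Rightarrow> 'a \<Rightarrow> real^'p" and W :: "(real^'f) set"
  assumes \<theta>hat_measurable [measurable]: "\<theta>hat n \<in> borel_measurable M"
    and \<theta>hat_in: "\<theta>hat n \<omega> \<in> \<Theta>"
    and A_invertible: "invertible A"
    and \<theta>hat_linear: "tendsto_0_in_prob M (\<lambda>n \<omega>.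
          sqrt (real (r n)) *\<^sub>R (\<theta>hat n \<omega> - \<theta>) -
          (1 / sqrt (real (r n))) *\<^sub>R
            (matrix_inv A *v (\<Sum>i=1..r n. score g (X i \<omega>) (Y i \<omega>) \<theta>)))"
    and W [measurable]: "W \<in> sets borel"
    and W_pos: "\<P>(\<omega> in M. X 0 \<omega> \<in> W) > 0"
begin

definition dev :: "nat \<Rightarrow> 'a \<Rightarrow> real^'p" where
  "dev n \<omega> = sqrt (real n) *\<^sub>R (\<theta>hat n \<omega> - \<theta>)"

lemma measurable_dev [measurable]: "dev n \<in> borel_measurable M"
  unfolding dev_def[abs_def] by measurable

lemma r_pos_ev: "\<forall>\<^sub>F n in sequentially. 0 < r n"
  using order_tendstoD(1)[OF r_lim \<gamma>_pos] by eventually_elim (auto intro: gr0I)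

lemma inverse_r_lim: "(\<lambda>n. real n / real (r n)) \<longlonglongrightarrow> 1 / \<gamma>"
  using tendsto_inverse[OF r_lim] \<gamma>_pos by (simp add: inverse_eq_divide)

lemma measurable_score [measurable]: "(\<lambda>\<omega>. score g (X i \<omega>) (Y i \<omega>) \<theta>) \<in> borel_measurable M"
  unfolding score_def by measurable

text \<open>The hypothesis is scaled by sqrt r, \<open>dev\<close> by sqrt n. Rescaling multiplies
  the remainder by sqrt(n / r), which converges, and the score sum by n / r; replacing the latter by
  1 / \<open>\<gamma>\<close> costs a bounded block sum times a null sequence. The inverse matrix is
  moved onto the direction \<open>d\<close>.\<close>

lemma dev_linear:
  "tendsto_0_in_prob M (\<lambda>n \<omega>. d \<bullet> dev n \<omega> - block_sum (\<lambda>z. (1 / \<gamma>) * score_along (d v* matrix_inv A) z) (\<lambda>_. 0) n \<omega>)"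
proof -
  let ?e = "d v* matrix_inv A"
  let ?S = "block_sum (score_along ?e) (\<lambda>_. 0)"
  define rem where "rem n \<omega> = sqrt (real (r n)) *\<^sub>R (\<theta>hat n \<omega> - \<theta>) -
          (1 / sqrt (real (r n))) *\<^sub>R
            (matrix_inv A *v (\<Sum>i=1..r n. score g (X i \<omega>) (Y i \<omega>) \<theta>))" for n \<omega>
  have [measurable]: "(\<lambda>v. matrix_inv A *v v) \<in> borel_measurable borel"
    by (intro borel_measurable_continuous_onI linear_continuous_on linear_linear[THEN iffD2] matrix_vector_mul_linear)
  have [measurable]: "rem n \<in> borel_measurable M" for n
    unfolding rem_def[abs_def] by measurable
  have [measurable]: "?S n \<in> borel_measurable M" for n
    by (intro borel_measurable_block_sum) auto
  have "tendsto_0_in_prob M (\<lambda>n \<omega>. norm (rem n \<omega>))"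
    by (rule tendsto_0_in_prob_mono[OF \<theta>hat_linear[folded rem_def]]) auto
  then have "tendsto_0_in_prob M (\<lambda>n \<omega>. norm d * norm (rem n \<omega>))"
    by (intro tendsto_0_in_prob_mult[OF bounded_in_prob_const[OF tendsto_const]]) auto
  then have R: "tendsto_0_in_prob M (\<lambda>n \<omega>. d \<bullet> rem n \<omega>)"
    by (rule tendsto_0_in_prob_mono) (auto simp: Cauchy_Schwarz_ineq2)
  have "(\<lambda>n. sqrt (real n / real (r n))) \<longlonglongrightarrow> sqrt (1 / \<gamma>)"
    by (intro tendsto_real_sqrt inverse_r_lim)
  then have 1: "tendsto_0_in_prob M (\<lambda>n \<omega>. sqrt (real n / real (r n)) * (d \<bullet> rem n \<omega>))"
    by (intro tendsto_0_in_prob_mult[OF bounded_in_prob_const R]) auto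
  have "(\<lambda>n. real n / real (r n) - 1 / \<gamma>) \<longlonglongrightarrow> 0"
    using inverse_r_lim by (rule LIM_zero)
  then have 2: "tendsto_0_in_prob M (\<lambda>n \<omega>. ?S n \<omega> * (real n / real (r n) - 1 / \<gamma>))"
    by (intro tendsto_0_in_prob_mult bounded_in_prob_block_sum tendsto_0_in_prob_const centred_L2_score_along) auto
  show ?thesis
  proof (rule tendsto_0_in_prob_cong[OF tendsto_0_in_prob_add[OF 1 2]])
    show "\<forall>\<^sub>F n in sequentially. \<forall>\<omega>\<in>space M.
       d \<bullet> dev n \<omega> - block_sum (\<lambda>z. (1 / \<gamma>) * score_along ?e z) (\<lambda>_. 0) n \<omega> =
       sqrt (real n / real (r n)) * (d \<bullet> rem n \<omega>) + ?S n \<omega> * (real n / real (r n) - 1 / \<gamma>)"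
      using r_pos_ev
    proof eventually_elim
      case (elim n)
      have n: "n > 0" using elim r_le[of n] by simp
      show ?case
      proof
        fix \<omega> assume "\<omega> \<in> space M"
        let ?\<Sigma> = "\<Sum>i=1..r n. score_along ?e (X i \<omega>, Y i \<omega>)"
        have "d \<bullet> (matrix_inv A *v (\<Sum>i=1..r n. score g (X i \<omega>) (Y i \<omega>) \<theta>)) = ?\<Sigma>"
          by (simp add: dot_lmul_matrix[symmetric] inner_sum_right score_along_def inner_commute)
        then have "d \<bullet> rem n \<omega> = sqrt (real (r n)) * (d \<bullet> (\<theta>hat n \<omega> - \<theta>)) - ?\<Sigma> / sqrt (real (r n))"
          by (simp add: rem_def inner_diff_right)
        \<comment> \<open>Used with a = sqrt r and b = sqrt n, so that a * a turns into r.\<close>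
        moreover have "b / a * (a * x - s / a) = b * x - b * s / (a * a)" if "a > 0" for a b x s :: real
          using that by (simp add: field_simps)
        from this[of "sqrt (real (r n))" "sqrt (real n)" "d \<bullet> (\<theta>hat n \<omega> - \<theta>)" ?\<Sigma>]
        have "sqrt (real n) / sqrt (real (r n)) *
            (sqrt (real (r n)) * (d \<bullet> (\<theta>hat n \<omega> - \<theta>)) - ?\<Sigma> / sqrt (real (r n))) =
          sqrt (real n) * (d \<bullet> (\<theta>hat n \<omega> - \<theta>)) - sqrt (real n) * ?\<Sigma> / real (r n)"
          using elim by simp
        ultimately have "sqrt (real n / real (r n)) * (d \<bullet> rem n \<omega>) =
          sqrt (real n) * (d \<bullet> (\<theta>hat n \<omega> - \<theta>)) - sqrt (real n) * ?\<Sigma> / real (r n)"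
          by (simp add: real_sqrt_divide)
        moreover have "sqrt (real n) * ?\<Sigma> / real (r n) = ?S n \<omega> * (real n / real (r n))"
          using elim n by (simp add: block_sum_labelled field_simps)
        moreover have "block_sum (\<lambda>z. (1 / \<gamma>) * score_along ?e z) (\<lambda>_. 0) n \<omega> = (1 / \<gamma>) * ?S n \<omega>"
          using block_sum_cmult[of "1 / \<gamma>" "score_along ?e" "\<lambda>_. 0" n \<omega>] by simp
        ultimately show "d \<bullet> dev n \<omega> - block_sum (\<lambda>z. (1 / \<gamma>) * score_along ?e z) (\<lambda>_. 0) n \<omega> =
          sqrt (real n / real (r n)) * (d \<bullet> rem n \<omega>) + ?S n \<omega> * (real n / real (r n) - 1 / \<gamma>)"
          unfolding dev_def inner_scaleR_right right_diff_distrib mult.commute[of "?S n \<omega>"]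
          by linarith
      qed
    qed
  qed measurable
qed

lemma centred_L2_scaled_score_along: "centred_L2 (\<lambda>z. (1 / \<gamma>) * score_along d z)"
  using centred_L2_score_along[of d] by (auto simp: centred_L2_def power_mult_distrib power_divide)

lemma dev_inner_bounded: "bounded_in_prob M (\<lambda>n \<omega>. d \<bullet> dev n \<omega>)"
proof -
  let ?f = "\<lambda>z. (1 / \<gamma>) * score_along (d v* matrix_inv A) z"
  have f: "centred_L2 ?f"
    by (rule centred_L2_scaled_score_along)
  have [measurable]: "block_sum ?f (\<lambda>_. 0) n \<in> borel_measurable M" for n
    by (intro borel_measurable_block_sum) auto
  have "bounded_in_prob M (\<lambda>n \<omega>. (d \<bullet> dev n \<omega> - block_sum ?f (\<lambda>_. 0) n \<omega>) + block_sum ?f (\<lambda>_. 0) n \<omega>)"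
    by (intro bounded_in_prob_add tendsto_0_in_prob_imp_bounded[OF dev_linear] bounded_in_prob_block_sum f)
      (simp_all add: borel_measurable_block_sum del: times_divide_eq_left mult_1_left)
  then show ?thesis by simp
qed

lemma dev_bounded: "bounded_in_prob M dev"
proof -
  have "bounded_in_prob M (\<lambda>n \<omega>. \<Sum>b\<in>Basis. (b \<bullet> dev n \<omega>) *\<^sub>R b)"
  proof (rule bounded_in_prob_sum)
    show "bounded_in_prob M (\<lambda>n \<omega>. (b \<bullet> dev n \<omega>) *\<^sub>R b)" if "b \<in> Basis" for b
      by (rule bounded_in_prob_mono[OF dev_inner_bounded[of b]]) (use that in auto)
  qed auto
  moreover have "dev n \<omega> = (\<Sum>b\<in>Basis. (b \<bullet> dev n \<omega>) *\<^sub>R b)" for n \<omega>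
    by (simp add: inner_commute[of _ "dev n \<omega>"] euclidean_representation)
  ultimately show ?thesis by simp
qed

section \<open>First-order expansion of the summands in the parameter\<close>

abbreviation "I t \<equiv> indicat_real W t"

definition taylor_rem :: "nat \<Rightarrow> 'a \<Rightarrow> real" where
  "taylor_rem n \<omega> = (\<Sum>i=1..n. I (X i \<omega>) *
     (g (X i \<omega>) (\<theta>hat n \<omega>) - g0 (X i \<omega>) - G (X i \<omega>) \<bullet> (\<theta>hat n \<omega> - \<theta>))) / sqrt (real n)"

lemma measurable_g_hat [measurable]: "(\<lambda>\<omega>. g (X i \<omega>) (\<theta>hat n \<omega>)) \<in> borel_measurable M"
  by (rule borel_measurable_g) (auto simp: \<theta>hat_in)

lemma measurable_taylor_rem [measurable]: "taylor_rem n \<in> borel_measurable M"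
  unfolding taylor_rem_def[abs_def] by measurable

text \<open>Once \<open>\<theta>hat\<close> is in the ball, the remainder is at most the average of
  m(X i) times |dev|. With high probability |dev| \<le> K and the average is below c =
  \<open>\<epsilon>\<close> / K, so the product stays within \<open>\<epsilon>\<close>.\<close>

lemma taylor_rem_small: "tendsto_0_in_prob M taylor_rem"
proof (rule tendsto_0_in_probI)
  fix \<epsilon> \<delta> :: real assume \<epsilon>: "\<epsilon> > 0" and \<delta>: "\<delta> > 0"
  then have "\<delta> / 4 > 0" by simp
  with dev_bounded obtain K where K: "K > 0"
    "\<forall>\<^sub>F n in sequentially. prob {\<omega> \<in> space M. norm (dev n \<omega>) > K} < \<delta> / 4"
    unfolding bounded_in_prob_def by blast
  \<comment> \<open>The modulus is chosen with mean below c \<open>\<delta>\<close> / 4, so Markov's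
    inequality bounds by \<open>\<delta>\<close> / 4 the probability that its average reaches c. Two
    more quarters go to the events for K and for the ball.\<close>
  define c where "c = \<epsilon> / K"
  have c: "c > 0" using \<epsilon> K by (simp add: c_def)
  then have "c * (\<delta> / 4) > 0" using \<delta> by simp
  then obtain \<rho> m where \<rho>: "\<rho> > 0" "ball \<theta> \<rho> \<subseteq> U" and [measurable]: "m \<in> borel_measurable borel"
    and m: "\<And>t \<eta>. \<eta> \<in> ball \<theta> \<rho> \<Longrightarrow> ennreal (norm (gradient (g t) \<eta> - G t)) \<le> m t"
    and mE: "(\<integral>\<^sup>+\<omega>. m (X 0 \<omega>) \<partial>M) < ennreal (c * (\<delta> / 4))"
    by (rule ex_gradient_modulus) blast
  let ?avg = "\<lambda>n \<omega>. (\<Sum>i=1..n. m (X i \<omega>)) / of_nat n"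
  have avg: "prob {\<omega> \<in> space M. 1 \<le> ennreal (1 / c) * ?avg n \<omega>} < \<delta> / 4" if "n > 0" for n
  proof -
    have "emeasure M {\<omega> \<in> space M. 1 \<le> ennreal (1 / c) * ?avg n \<omega>} \<le>
        ennreal (1 / c) * (\<integral>\<^sup>+\<omega>. ?avg n \<omega> * indicator (space M) \<omega> \<partial>M)"
      by (rule nn_integral_Markov_inequality) auto
    also have "(\<integral>\<^sup>+\<omega>. ?avg n \<omega> * indicator (space M) \<omega> \<partial>M) = (\<integral>\<^sup>+\<omega>. ?avg n \<omega> \<partial>M)"
      by (intro nn_integral_cong) auto
    also have "\<dots> = (\<Sum>i=1..n. \<integral>\<^sup>+\<omega>. m (X i \<omega>) \<partial>M) / of_nat n"
      by (simp add: nn_integral_divide nn_integral_sum)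
    also have "\<dots> = (\<Sum>i=1..n. \<integral>\<^sup>+\<omega>. m (X 0 \<omega>) \<partial>M) / of_nat n"
      using nn_integral_Z[of "\<lambda>z. m (fst z)"]
      by (intro arg_cong2[where f="(/)"] sum.cong refl) simp
    also have "\<dots> = (\<integral>\<^sup>+\<omega>. m (X 0 \<omega>) \<partial>M)"
      using that by (simp add: mult_divide_eq_ennreal mult.commute[of "of_nat n"])
    also have "ennreal (1 / c) * (\<integral>\<^sup>+\<omega>. m (X 0 \<omega>) \<partial>M) < ennreal (1 / c) * ennreal (c * (\<delta> / 4))"
      using c mE by (intro ennreal_mult_strict_left_mono) (auto simp: ennreal_zero_less_divide)
    also have "\<dots> = ennreal (\<delta> / 4)"
      using c \<delta> by (subst ennreal_mult[symmetric]) auto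
    finally show ?thesis
      by (simp add: emeasure_eq_measure ennreal_less_iff)
  qed
  \<comment> \<open>This product is |\<open>\<theta>hat\<close> - \<open>\<theta>\<close>|:
    tightness of \<open>dev\<close> yields the consistency that puts \<open>\<theta>hat\<close> in
    the ball.\<close>
  have cons: "tendsto_0_in_prob M (\<lambda>n \<omega>. norm (dev n \<omega>) * (1 / sqrt (real n)))"
  proof (intro tendsto_0_in_prob_mult tendsto_0_in_prob_const)
    show "bounded_in_prob M (\<lambda>n \<omega>. norm (dev n \<omega>))"
      by (rule bounded_in_prob_mono[OF dev_bounded]) auto
    show "(\<lambda>n. 1 / sqrt (real n)) \<longlonglongrightarrow> 0"
      by (intro tendsto_divide_0[OF tendsto_const] filterlim_at_top_imp_at_infinity
        filterlim_compose[OF sqrt_at_top] filterlim_real_sequentially)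
  qed auto
  have "\<rho> / 2 > 0" using \<rho> by simp
  from K(2) tendsto_0_in_probD[OF cons this \<open>\<delta> / 4 > 0\<close>] eventually_gt_at_top[of 0]
  show "\<forall>\<^sub>F n in sequentially. prob {\<omega> \<in> space M. norm (taylor_rem n \<omega>) > \<epsilon>} < \<delta>"
  proof eventually_elim
    case (elim n)
    let ?E1 = "{\<omega> \<in> space M. norm (dev n \<omega>) > K}"
    let ?E2 = "{\<omega> \<in> space M. norm (norm (dev n \<omega>) * (1 / sqrt (real n))) > \<rho> / 2}"
    let ?E3 = "{\<omega> \<in> space M. 1 \<le> ennreal (1 / c) * ?avg n \<omega>}"
    have 12: "prob (?E1 \<union> ?E2) < \<delta> / 2"
      by (rule prob_less_of_subset_Un[OF elim(1,2)]) auto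
    show ?case
    proof (rule prob_less_of_subset_Un[OF 12 avg[OF elim(3)]])
      show "{\<omega> \<in> space M. norm (taylor_rem n \<omega>) > \<epsilon>} \<subseteq> (?E1 \<union> ?E2) \<union> ?E3"
      proof (rule ccontr)
        assume "\<not> ?thesis"
        then obtain \<omega> where \<omega>: "\<omega> \<in> space M" "norm (taylor_rem n \<omega>) > \<epsilon>"
          and "\<omega> \<notin> ?E1" "\<omega> \<notin> ?E2" "\<omega> \<notin> ?E3" by blast
        then have e1: "norm (dev n \<omega>) \<le> K"
          and e2: "norm (dev n \<omega>) * (1 / sqrt (real n)) \<le> \<rho> / 2"
          and e3: "ennreal (1 / c) * ?avg n \<omega> < 1" by (auto simp: not_less not_le)
        let ?h = "\<theta>hat n \<omega> - \<theta>"
        have dn: "norm (dev n \<omega>) = sqrt (real n) * norm ?h" by (simp add: dev_def)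
        have "norm ?h \<le> \<rho> / 2" using e2 elim(3) unfolding dn by simp
        then have \<theta>b: "\<theta>hat n \<omega> \<in> ball \<theta> \<rho>"
          using \<rho> by (simp add: dist_norm norm_minus_commute)
        \<comment> \<open>The modulus may be infinite. A finite average forces every m(X i) in it to
          be finite, after which the computation can move to the reals.\<close>
        have "?avg n \<omega> \<noteq> \<infinity>"
        proof
          assume "?avg n \<omega> = \<infinity>"
          with e3 c show False by (simp add: ennreal_mult_top)
        qed
        then have fin: "m (X i \<omega>) < \<infinity>" if "i \<in> {1..n}" for i
          using that elim(3) by (auto simp: ennreal_divide_eq_top_iff less_top)
        define mr where "mr i = enn2real (m (X i \<omega>))" for i
        have mr: "m (X i \<omega>) = ennreal (mr i)" "mr i \<ge> 0" if "i \<in> {1..n}" for i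
          using fin[OF that] by (auto simp: mr_def)
        have "?avg n \<omega> = ennreal ((\<Sum>i=1..n. mr i) / real n)"
        proof -
          have "(\<Sum>i=1..n. m (X i \<omega>)) = ennreal (\<Sum>i=1..n. mr i)"
            using mr sum_ennreal[of "{1..n}" mr] by simp
          moreover have "(\<Sum>i=1..n. mr i) \<ge> 0" using mr(2) by (rule sum_nonneg)
          ultimately show ?thesis
            using elim(3) by (simp only: divide_ennreal ennreal_of_nat_eq_real_of_nat of_nat_0_less_iff)
        qed
        then have "ennreal ((1 / c) * ((\<Sum>i=1..n. mr i) / real n)) < 1"
          using e3 c by (subst ennreal_mult) (auto intro!: divide_nonneg_nonneg sum_nonneg mr(2))
        then have "(\<Sum>i=1..n. mr i) / real n / c < 1"
          by (simp add: mult.commute)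
        then have avg_le: "(\<Sum>i=1..n. mr i) / real n < c"
          using c by (simp only: pos_divide_less_eq mult_1_left)
        have summand: "\<bar>I (X i \<omega>) * (g (X i \<omega>) (\<theta>hat n \<omega>) - g0 (X i \<omega>) - G (X i \<omega>) \<bullet> ?h)\<bar> \<le> mr i * norm ?h"
          if i: "i \<in> {1..n}" for i
        proof -
          have "\<bar>g (X i \<omega>) (\<theta>hat n \<omega>) - g0 (X i \<omega>) - G (X i \<omega>) \<bullet> ?h\<bar> \<le> mr i * norm ?h"
          proof (rule linearization_error[OF _ _ \<theta>b])
            fix \<xi> assume \<xi>: "\<xi> \<in> ball \<theta> \<rho>"
            then show "g (X i \<omega>) differentiable (at \<xi>)" using \<rho> by (intro g_diff) auto
            show "norm (gradient (g (X i \<omega>)) \<xi> - G (X i \<omega>)) \<le> mr i"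
              using m[OF \<xi>, of "X i \<omega>"] mr[OF i] by simp
          qed
          then show ?thesis
            using mr(2)[OF i] by (auto simp: indicator_def)
        qed
        have "norm (taylor_rem n \<omega>) \<le> (\<Sum>i=1..n. mr i * norm ?h) / sqrt (real n)"
        proof -
          have "\<bar>\<Sum>i=1..n. I (X i \<omega>) * (g (X i \<omega>) (\<theta>hat n \<omega>) - g0 (X i \<omega>) - G (X i \<omega>) \<bullet> ?h)\<bar> \<le>
              (\<Sum>i=1..n. mr i * norm ?h)"
            by (intro order_trans[OF sum_abs] sum_mono summand)
          then show ?thesis
            unfolding taylor_rem_def real_norm_def abs_divide
            by (simp only: divide_right_mono abs_of_nonneg real_sqrt_ge_zero of_nat_0_le_iff)
        qed
        also have "\<dots> = (\<Sum>i=1..n. mr i) / real n * norm (dev n \<omega>)"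
          unfolding dn sum_distrib_right[symmetric] using elim(3)
          by (simp add: field_simps)
        also have "\<dots> \<le> c * K"
          using avg_le e1 c by (intro mult_mono) auto
        also have "\<dots> = \<epsilon>" using K by (simp add: c_def)
        finally show False using \<omega> by simp
      qed
    qed (use \<delta> in auto)
  qed
qed

section \<open>Limiting variances\<close>

definition "p = \<P>(\<omega> in M. X 0 \<omega> \<in> W)"
definition "q = expectation (\<lambda>\<omega>. I (X 0 \<omega>) * g0 (X 0 \<omega>)) / p"
definition "\<kappa> = expectation (\<lambda>\<omega>. I (X 0 \<omega>) * (g0 (X 0 \<omega>))\<^sup>2)"
definition B :: "real^'p" where "B = (\<chi> k. expectation (\<lambda>\<omega>. I (X 0 \<omega>) * (G (X 0 \<omega>) $ k)))"
text \<open>The row vector B^T A^-1. It is the direction in which the score enters the limit of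
  \<open>q_hat\<close>, and also the coefficient vector of the w-weighted projection of I g (1 - g)
  onto the coordinates of g'.\<close>

definition c :: "real^'p" where "c = B v* matrix_inv A"

lemma p_pos: "p > 0"
  using W_pos by (simp add: p_def)

lemma g0_abs: "\<bar>g0 t\<bar> \<le> 1"
  using g0_bounds[of t] by simp

lemma I_mult: "I t * I t = I t" "I t * (I t * x) = I t * x"
  by (auto simp: indicator_def)

lemma integrable_bounded:
  fixes \<phi> :: "real^'f \<Rightarrow> real"
  assumes "\<phi> \<in> borel_measurable borel" "\<And>t. \<bar>\<phi> t\<bar> \<le> C"
  shows "integrable M (\<lambda>\<omega>. \<phi> (X 0 \<omega>))"
  using integrable_bounded_mult[OF assms, of "\<lambda>_. 1"] by simp

lemma integrable_I: "integrable M (\<lambda>\<omega>. I (X 0 \<omega>))"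
  by (rule integrable_bounded[where C=1]) (auto simp: indicator_def)

lemma integrable_Ig: "integrable M (\<lambda>\<omega>. I (X 0 \<omega>) * g0 (X 0 \<omega>))"
  by (rule integrable_bounded[where C=1]) (use g0_abs in \<open>auto simp: indicator_def\<close>)

lemma integrable_Igg: "integrable M (\<lambda>\<omega>. I (X 0 \<omega>) * (g0 (X 0 \<omega>))\<^sup>2)"
  by (rule integrable_bounded[where C=1])
    (use g0_abs in \<open>auto simp: indicator_def abs_square_le_1\<close>)

lemma expectation_I: "expectation (\<lambda>\<omega>. I (X 0 \<omega>)) = p"
proof -
  have "expectation (\<lambda>\<omega>. I (X 0 \<omega>)) = expectation (indicat_real {\<omega> \<in> space M. X 0 \<omega> \<in> W})"
    by (intro Bochner_Integration.integral_cong) (auto simp: indicator_def)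
  then show ?thesis by (simp add: p_def)
qed

lemma expectation_Ig: "expectation (\<lambda>\<omega>. I (X 0 \<omega>) * g0 (X 0 \<omega>)) = p * q"
  using p_pos by (simp add: q_def)

lemma integrable_IY: "integrable M (\<lambda>\<omega>. I (X 0 \<omega>) * Y 0 \<omega>)"
  and expectation_IY: "expectation (\<lambda>\<omega>. I (X 0 \<omega>) * Y 0 \<omega>) = p * q"
  using expectation_mult_response[OF disjI1, OF conjI[OF refl refl] _ integrable_Ig] expectation_Ig by auto

text \<open>The locale defines \<open>q\<close> through g, the form used in the variance
  computations; the model equation identifies it with the estimated probability.\<close>

lemma q_cond_prob: "q = \<P>(\<omega> in M. Y 0 \<omega> = 1 \<bar> X 0 \<omega> \<in> W)"
proof -
  have "expectation (\<lambda>\<omega>. I (X 0 \<omega>) * Y 0 \<omega>) =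
      expectation (indicat_real {\<omega> \<in> space M. Y 0 \<omega> = 1 \<and> X 0 \<omega> \<in> W})"
    using Y_01[of _ 0] by (intro Bochner_Integration.integral_cong) (auto simp: indicator_def)
  also have "\<dots> = \<P>(\<omega> in M. Y 0 \<omega> = 1 \<and> X 0 \<omega> \<in> W)" by simp
  finally have "\<P>(\<omega> in M. Y 0 \<omega> = 1 \<and> X 0 \<omega> \<in> W) = p * q"
    by (simp add: expectation_IY)
  then show ?thesis
    using p_pos by (simp add: cond_prob_def p_def[symmetric])
qed

lemma B_inner: "B \<bullet> d = expectation (\<lambda>\<omega>. I (X 0 \<omega>) * (G (X 0 \<omega>) \<bullet> d))"
  and integrable_IG: "integrable M (\<lambda>\<omega>. I (X 0 \<omega>) * (G (X 0 \<omega>) \<bullet> d))"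
proof -
  have int: "integrable M (\<lambda>\<omega>. I (X 0 \<omega>) * (G (X 0 \<omega>) \<bullet> e))" for e
    by (rule integrable_bounded_mult[OF _ _ integrable_G, where C=1]) (auto simp: indicator_def)
  then show "integrable M (\<lambda>\<omega>. I (X 0 \<omega>) * (G (X 0 \<omega>) \<bullet> d))" .
  have int': "integrable M (\<lambda>\<omega>. I (X 0 \<omega>) * (G (X 0 \<omega>) $ k))" for k
    using int[of "axis k 1"] by (simp add: inner_axis)
  have "B \<bullet> d = (\<Sum>k\<in>UNIV. expectation (\<lambda>\<omega>. I (X 0 \<omega>) * (G (X 0 \<omega>) $ k) * d $ k))"
    by (simp add: B_def inner_vec_def)
  also have "\<dots> = expectation (\<lambda>\<omega>. \<Sum>k\<in>UNIV. I (X 0 \<omega>) * (G (X 0 \<omega>) $ k) * d $ k)"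
    using int' by (intro Bochner_Integration.integral_sum[symmetric]) auto
  finally show "B \<bullet> d = expectation (\<lambda>\<omega>. I (X 0 \<omega>) * (G (X 0 \<omega>) \<bullet> d))"
    by (simp add: inner_vec_def sum_distrib_left mult_ac)
qed

text \<open>By definition of \<open>c\<close>, pairing it with A c applies
  \<open>matrix_inv A\<close> to A c. This makes the variance of the score term and the mixed term
  of the projection argument the same number.\<close>

lemma c_quadratic: "c \<bullet> (A *v c) = B \<bullet> c"
  by (simp add: c_def dot_lmul_matrix matrix_inv_mult_vec[OF A_invertible])

text \<open>The first-order term of \<open>q_hat\<close> due to the estimated parameter is at most as variable as the
  residuals \<open>Y - g\<close> on \<open>W\<close>: expand the mean of the square \<open>w (g' c - I g (1 - g))\<^sup>2\<close>.\<close>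

lemma B_c_le: "B \<bullet> c \<le> p * q - \<kappa>"
proof -
  have eq: "w t * (G t \<bullet> c - I t * (g0 t * (1 - g0 t)))\<^sup>2 =
      w t * (G t \<bullet> c)\<^sup>2 - 2 * (I t * (G t \<bullet> c)) + (I t * g0 t - I t * (g0 t)\<^sup>2)" for t
  proof -
    have "w t * (G t \<bullet> c - I t * (g0 t * (1 - g0 t)))\<^sup>2 = w t * (G t \<bullet> c)\<^sup>2
        - 2 * ((w t * (g0 t * (1 - g0 t))) * (I t * (G t \<bullet> c)))
        + (w t * (g0 t * (1 - g0 t))) * ((I t * I t) * (g0 t * (1 - g0 t)))"
      by (simp add: power2_eq_square algebra_simps)
    then show ?thesis
      unfolding w_mult I_mult by (simp add: power2_eq_square algebra_simps)
  qed
  have "0 \<le> expectation (\<lambda>\<omega>. w (X 0 \<omega>) * (G (X 0 \<omega>) \<bullet> c - I (X 0 \<omega>) * (g0 (X 0 \<omega>) * (1 - g0 (X 0 \<omega>))))\<^sup>2)"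
    using w_pos by (intro integral_nonneg_AE) (auto simp: less_imp_le)
  \<comment> \<open>The first two terms collapse to - B \<bullet> c by \<open>c_quadratic\<close>,
    which leaves exactly the claimed inequality.\<close>
  also have "\<dots> = c \<bullet> (A *v c) - 2 * (B \<bullet> c) + (p * q - \<kappa>)"
    unfolding eq using integrable_quadratic_info[of c] integrable_IG[of c] integrable_Ig integrable_Igg
    by (simp add: expectation_quadratic_info B_inner expectation_Ig \<kappa>_def)
  finally show ?thesis by (simp add: c_quadratic)
qed

lemma variance_Ig: "expectation (\<lambda>\<omega>. (I (X 0 \<omega>) * g0 (X 0 \<omega>) - p * q)\<^sup>2) = \<kappa> - p\<^sup>2 * q\<^sup>2"
  and integrable_variance_Ig: "integrable M (\<lambda>\<omega>. (I (X 0 \<omega>) * g0 (X 0 \<omega>) - p * q)\<^sup>2)"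
proof -
  have eq: "(I t * g0 t - p * q)\<^sup>2 = I t * (g0 t)\<^sup>2 - 2 * p * q * (I t * g0 t) + p\<^sup>2 * q\<^sup>2" for t
    by (simp add: power2_eq_square algebra_simps I_mult)
  show "integrable M (\<lambda>\<omega>. (I (X 0 \<omega>) * g0 (X 0 \<omega>) - p * q)\<^sup>2)"
    unfolding eq using integrable_Ig integrable_Igg by simp
  show "expectation (\<lambda>\<omega>. (I (X 0 \<omega>) * g0 (X 0 \<omega>) - p * q)\<^sup>2) = \<kappa> - p\<^sup>2 * q\<^sup>2"
  proof -
    have "expectation (\<lambda>\<omega>. (I (X 0 \<omega>) * g0 (X 0 \<omega>) - p * q)\<^sup>2) = \<kappa> - 2 * p * q * (p * q) + p\<^sup>2 * q\<^sup>2"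
      unfolding eq using integrable_Ig integrable_Igg
      by (simp add: expectation_Ig \<kappa>_def[symmetric] prob_space)
    then show ?thesis by (simp add: power2_eq_square)
  qed
qed

section \<open>Limit law of \<open>q_hat\<close>\<close>

definition D :: "nat \<Rightarrow> 'a \<Rightarrow> real" where "D n \<omega> = (\<Sum>i=1..n. I (X i \<omega>)) / real n"

lemma measurable_D [measurable]: "D n \<in> borel_measurable M"
  unfolding D_def[abs_def] by measurable

lemma D_law: "tendsto_0_in_prob M (\<lambda>n \<omega>. D n \<omega> - p)"
  using weak_law[of "\<lambda>z. I (fst z)"] integrable_I
  by (simp add: D_def expectation_I I_mult power2_eq_square)

definition f_hat :: "(real^'f) \<times> real \<Rightarrow> real" where "f_hat z = I (fst z) * (g0 (fst z) - q)"
text \<open>\<open>f_hat\<close> is the summand for a known parameter. The added score term is the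
  influence of \<open>\<theta>hat\<close>; its factor 1 / \<open>\<gamma>\<close> is the limit of n
  / r, since the parameter is averaged over r observations and the statistic over n.\<close>

definition f_lab :: "(real^'f) \<times> real \<Rightarrow> real" where "f_lab z = f_hat z + (1 / \<gamma>) * score_along c z"

lemma measurable_f_hat [measurable]: "f_hat \<in> borel_measurable (borel \<Otimes>\<^sub>M borel)"
  unfolding f_hat_def[abs_def] by measurable

lemma measurable_f_lab [measurable]: "f_lab \<in> borel_measurable (borel \<Otimes>\<^sub>M borel)"
  unfolding f_lab_def[abs_def] by measurable

lemma f_hat_square:
  "integrable M (\<lambda>\<omega>. (f_hat (X 0 \<omega>, Y 0 \<omega>))\<^sup>2)"
  "expectation (\<lambda>\<omega>. (f_hat (X 0 \<omega>, Y 0 \<omega>))\<^sup>2) = \<kappa> - q\<^sup>2 * p"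
proof -
  have eq: "(f_hat (t, y))\<^sup>2 = I t * (g0 t)\<^sup>2 - 2 * q * (I t * g0 t) + q\<^sup>2 * I t" for t y
    by (simp add: f_hat_def power2_eq_square algebra_simps I_mult)
  show "integrable M (\<lambda>\<omega>. (f_hat (X 0 \<omega>, Y 0 \<omega>))\<^sup>2)"
    unfolding eq using integrable_I integrable_Ig integrable_Igg by simp
  show "expectation (\<lambda>\<omega>. (f_hat (X 0 \<omega>, Y 0 \<omega>))\<^sup>2) = \<kappa> - q\<^sup>2 * p"
  proof -
    have "expectation (\<lambda>\<omega>. (f_hat (X 0 \<omega>, Y 0 \<omega>))\<^sup>2) = \<kappa> - 2 * q * (p * q) + q\<^sup>2 * p"
      unfolding eq using integrable_I integrable_Ig integrable_Igg
      by (simp add: expectation_I expectation_Ig \<kappa>_def[symmetric])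
    then show ?thesis by (simp add: power2_eq_square)
  qed
qed

lemma centred_L2_f_hat: "centred_L2 f_hat"
proof -
  have "expectation (\<lambda>\<omega>. f_hat (X 0 \<omega>, Y 0 \<omega>)) =
      expectation (\<lambda>\<omega>. I (X 0 \<omega>) * g0 (X 0 \<omega>) - q * I (X 0 \<omega>))"
    by (simp add: f_hat_def algebra_simps)
  also have "\<dots> = 0"
    using integrable_I integrable_Ig by (simp add: expectation_I expectation_Ig)
  finally show ?thesis using f_hat_square by (simp add: centred_L2_def)
qed

text \<open>The cross term vanishes: \<open>f_hat\<close> is a bounded function of X, and the score
  is uncorrelated with such functions.\<close>

lemma f_lab_square:
  "integrable M (\<lambda>\<omega>. (f_lab (X 0 \<omega>, Y 0 \<omega>))\<^sup>2)"
  "expectation (\<lambda>\<omega>. (f_lab (X 0 \<omega>, Y 0 \<omega>))\<^sup>2) = \<kappa> - q\<^sup>2 * p + (B \<bullet> c) / \<gamma>\<^sup>2"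
proof -
  have eq: "(f_lab (t, y))\<^sup>2 = (f_hat (t, y))\<^sup>2 + 2 / \<gamma> * (I t * (g0 t - q) * score_along c (t, y))
      + (score_along c (t, y))\<^sup>2 / \<gamma>\<^sup>2" for t y
    by (simp add: f_lab_def f_hat_def power2_sum power_divide)
  have bound: "\<bar>I t * (g0 t - q)\<bar> \<le> 1 + \<bar>q\<bar>" for t
    using g0_bounds[of t] by (auto simp: indicator_def)
  have m: "(\<lambda>t. I t * (g0 t - q)) \<in> borel_measurable borel" by measurable
  note unc = score_along_uncorrelated[of "\<lambda>t. I t * (g0 t - q)", OF m bound, of c]
  show "integrable M (\<lambda>\<omega>. (f_lab (X 0 \<omega>, Y 0 \<omega>))\<^sup>2)"
    unfolding eq using f_hat_square unc integrable_score_along_square[of c] by simp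
  show "expectation (\<lambda>\<omega>. (f_lab (X 0 \<omega>, Y 0 \<omega>))\<^sup>2) = \<kappa> - q\<^sup>2 * p + (B \<bullet> c) / \<gamma>\<^sup>2"
    unfolding eq using f_hat_square unc integrable_score_along_square[of c]
    by (simp add: expectation_score_along_square c_quadratic)
qed

lemma centred_L2_f_lab: "centred_L2 f_lab"
proof -
  have "integrable M (\<lambda>\<omega>. f_hat (X 0 \<omega>, Y 0 \<omega>))" "integrable M (\<lambda>\<omega>. score_along c (X 0 \<omega>, Y 0 \<omega>))"
    using f_hat_square(1) integrable_score_along_square[of c]
    by (auto intro!: square_integrable_imp_integrable)
  then have "expectation (\<lambda>\<omega>. f_lab (X 0 \<omega>, Y 0 \<omega>)) = 0"
    using centred_L2_f_hat centred_L2_score_along[of c] by (simp add: f_lab_def centred_L2_def)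
  then show ?thesis using f_lab_square(1) by (simp add: centred_L2_def)
qed

definition N_hat :: "nat \<Rightarrow> 'a \<Rightarrow> real" where
  "N_hat n \<omega> = (\<Sum>i=1..n. I (X i \<omega>) * (g (X i \<omega>) (\<theta>hat n \<omega>) - q)) / sqrt (real n)"

lemma measurable_N_hat [measurable]: "N_hat n \<in> borel_measurable M"
  unfolding N_hat_def[abs_def] by measurable

text \<open>Expanding g at \<open>\<theta>\<close> leaves \<open>taylor_rem\<close>, the block sum
  of \<open>f_hat\<close>, and the average of I G paired with \<open>dev\<close>. By the weak law,
  coordinate by coordinate, that average may be replaced by \<open>B\<close>, and B \<bullet> dev is
  then a score sum in the direction \<open>c\<close>.\<close>

lemma N_hat_linear: "tendsto_0_in_prob M (\<lambda>n \<omega>. N_hat n \<omega> - block_sum f_lab f_hat n \<omega>)"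
proof -
  \<comment> \<open>The error of the weak law in direction b. Its product with a coordinate of
    \<open>dev\<close>, which is bounded in probability, is negligible.\<close>
  define H where "H b n \<omega> = (\<Sum>i=1..n. I (X i \<omega>) * (G (X i \<omega>) \<bullet> b)) / real n - B \<bullet> b" for b n \<omega>
  have [measurable]: "H b n \<in> borel_measurable M" for b n
    unfolding H_def[abs_def] by measurable
  have H: "tendsto_0_in_prob M (H b)" for b
  proof -
    have eq: "(I t * (G t \<bullet> b))\<^sup>2 = I t * (G t \<bullet> b)\<^sup>2" for t
      by (simp add: power2_eq_square I_mult mult_ac)
    have "integrable M (\<lambda>\<omega>. (I (X 0 \<omega>) * (G (X 0 \<omega>) \<bullet> b))\<^sup>2)"
      unfolding eq
      by (rule integrable_bounded_mult[OF _ _ square_integrable_G, where C=1]) (auto simp: indicator_def)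
    then show ?thesis
      using weak_law[of "\<lambda>z. I (fst z) * (G (fst z) \<bullet> b)"] by (simp add: H_def[abs_def] B_inner)
  qed
  let ?S = "block_sum (\<lambda>z. (1 / \<gamma>) * score_along c z) (\<lambda>_. 0)"
  have [measurable]: "?S n \<in> borel_measurable M" for n
    by (intro borel_measurable_block_sum) auto
  have 1: "tendsto_0_in_prob M (\<lambda>n \<omega>. \<Sum>b\<in>Basis. (b \<bullet> dev n \<omega>) * H b n \<omega>)"
    by (intro tendsto_0_in_prob_sum tendsto_0_in_prob_mult dev_inner_bounded H) auto
  have 2: "tendsto_0_in_prob M (\<lambda>n \<omega>. B \<bullet> dev n \<omega> - ?S n \<omega>)"
    unfolding c_def by (rule dev_linear)
  have 12: "tendsto_0_in_prob M (\<lambda>n \<omega>. (\<Sum>b\<in>Basis. (b \<bullet> dev n \<omega>) * H b n \<omega>) + (B \<bullet> dev n \<omega> - ?S n \<omega>))"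
    by (rule tendsto_0_in_prob_add[OF 1 2]) measurable
  show ?thesis
  proof (rule tendsto_0_in_prob_cong[OF tendsto_0_in_prob_add[OF taylor_rem_small 12]])
    show "\<forall>\<^sub>F n in sequentially. \<forall>\<omega>\<in>space M. N_hat n \<omega> - block_sum f_lab f_hat n \<omega> =
      taylor_rem n \<omega> + ((\<Sum>b\<in>Basis. (b \<bullet> dev n \<omega>) * H b n \<omega>) + (B \<bullet> dev n \<omega> - ?S n \<omega>))"
      using eventually_gt_at_top[of 0]
    proof eventually_elim
      case (elim n)
      show ?case
      proof
        fix \<omega> assume "\<omega> \<in> space M"
        let ?h = "\<theta>hat n \<omega> - \<theta>"
        have "(\<Sum>b\<in>Basis. (b \<bullet> dev n \<omega>) * (H b n \<omega> + B \<bullet> b)) =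
            (\<Sum>b\<in>Basis. \<Sum>i=1..n. I (X i \<omega>) * ((G (X i \<omega>) \<bullet> b) * (dev n \<omega> \<bullet> b)) / real n)"
          by (simp add: H_def sum_distrib_left sum_divide_distrib inner_commute mult_ac
              del: sum_mult_indicator sum_indicator_mult)
        also have "\<dots> = (\<Sum>i=1..n. \<Sum>b\<in>Basis. I (X i \<omega>) * ((G (X i \<omega>) \<bullet> b) * (dev n \<omega> \<bullet> b)) / real n)"
          by (rule sum.swap)
        also have "\<dots> = (\<Sum>i=1..n. I (X i \<omega>) * (G (X i \<omega>) \<bullet> dev n \<omega>) / real n)"
          by (simp add: euclidean_inner[of _ "dev n \<omega>"] sum_distrib_left sum_divide_distrib
              del: sum_mult_indicator sum_indicator_mult)
        also have "\<dots> = (\<Sum>i=1..n. I (X i \<omega>) * (G (X i \<omega>) \<bullet> ?h) / sqrt (real n))"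
        proof (rule sum.cong[OF refl])
          fix i
          \<comment> \<open>Used with u = sqrt n: one factor comes from \<open>dev\<close>, and u *
            u is the averaging factor n.\<close>
          have "a * (u * x) / (u * u) = a * x / u" if "u > 0" for a u x :: real
            using that by simp
          from this[of "sqrt (real n)"]
          show "I (X i \<omega>) * (G (X i \<omega>) \<bullet> dev n \<omega>) / real n = I (X i \<omega>) * (G (X i \<omega>) \<bullet> ?h) / sqrt (real n)"
            using elim by (simp add: dev_def del: scaleR_right_diff_distrib)
        qed
        finally have *: "(\<Sum>b\<in>Basis. (b \<bullet> dev n \<omega>) * (H b n \<omega> + B \<bullet> b)) =
            (\<Sum>i=1..n. I (X i \<omega>) * (G (X i \<omega>) \<bullet> ?h) / sqrt (real n))" .
        have "(\<Sum>b\<in>Basis. (b \<bullet> dev n \<omega>) * H b n \<omega>) + B \<bullet> dev n \<omega> =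
            (\<Sum>i=1..n. I (X i \<omega>) * (G (X i \<omega>) \<bullet> ?h)) / sqrt (real n)"
        proof -
          have "B \<bullet> dev n \<omega> = (\<Sum>b\<in>Basis. (b \<bullet> dev n \<omega>) * (B \<bullet> b))"
            by (subst euclidean_inner) (simp add: inner_commute mult.commute)
          with * show ?thesis
            by (simp only: distrib_left sum.distrib sum_divide_distrib)
        qed
        moreover have "N_hat n \<omega> = taylor_rem n \<omega> + block_sum f_hat f_hat n \<omega> +
            (\<Sum>i=1..n. I (X i \<omega>) * (G (X i \<omega>) \<bullet> ?h)) / sqrt (real n)"
          unfolding N_hat_def taylor_rem_def block_sum_all f_hat_def add_divide_distrib[symmetric] sum.distrib[symmetric]
          by (simp add: algebra_simps)
        moreover have "block_sum f_lab f_hat n \<omega> = block_sum f_hat f_hat n \<omega> + ?S n \<omega>"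
          unfolding block_sum_add by (simp add: f_lab_def[abs_def])
        ultimately show "N_hat n \<omega> - block_sum f_lab f_hat n \<omega> =
          taylor_rem n \<omega> + ((\<Sum>b\<in>Basis. (b \<bullet> dev n \<omega>) * H b n \<omega>) + (B \<bullet> dev n \<omega> - ?S n \<omega>))"
          by simp
      qed
    qed
  qed measurable
qed

definition "V_hat = (\<gamma> * (\<kappa> - q\<^sup>2 * p + (B \<bullet> c) / \<gamma>\<^sup>2) + (1 - \<gamma>) * (\<kappa> - q\<^sup>2 * p)) / p\<^sup>2"

lemma q_hat_limit: "has_limiting_variance M (q_hat g W X \<theta>hat) q V_hat"
proof -
  have "has_limiting_variance M (q_hat g W X \<theta>hat) q
    ((\<gamma> * expectation (\<lambda>\<omega>. (f_lab (X 0 \<omega>, Y 0 \<omega>))\<^sup>2) +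
      (1 - \<gamma>) * expectation (\<lambda>\<omega>. (f_hat (X 0 \<omega>, Y 0 \<omega>))\<^sup>2)) / p\<^sup>2)"
  proof (rule ratio_limiting_variance[OF centred_L2_f_lab centred_L2_f_hat _ measurable_D
        measurable_N_hat N_hat_linear D_law p_pos])
    show "q_hat g W X \<theta>hat n \<in> borel_measurable M" for n
      unfolding q_hat_def[abs_def] by measurable
    fix n \<omega> assume n: "n > (0::nat)" and D: "D n \<omega> \<noteq> 0"
    define s where "s = (\<Sum>i=1..n. I (X i \<omega>))"
    have s: "s \<noteq> 0" using D by (simp add: D_def s_def)
    have "q_hat g W X \<theta>hat n \<omega> - q = (\<Sum>i=1..n. I (X i \<omega>) * (g (X i \<omega>) (\<theta>hat n \<omega>) - q)) / s"
      using s unfolding q_hat_def s_def[symmetric]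
      by (simp add: field_simps sum_subtractf s_def sum_distrib_left)
    then show "sqrt (real n) * (q_hat g W X \<theta>hat n \<omega> - q) = N_hat n \<omega> / D n \<omega>"
    proof -
      have "u * (x / s) = (x / u) / (s / (u * u))" if "u > 0" for u x
        using that s by (simp add: field_simps)
      from this[of "sqrt (real n)"] show ?thesis
        using n \<open>q_hat g W X \<theta>hat n \<omega> - q = _\<close> unfolding N_hat_def D_def s_def[symmetric] by simp
    qed
  qed
  then show ?thesis by (simp add: V_hat_def f_hat_square f_lab_square)
qed

section \<open>Limit law of \<open>Y_bar\<close>\<close>

definition y_c :: "(real^'f) \<times> real \<Rightarrow> real" where "y_c z = I (fst z) * snd z - p * q"
text \<open>The numerator of Y_bar - q is the labelled mean of I Y minus q times the full-sample
  mean of I, both with the mean p q. \<open>y_c\<close> and \<open>i_c\<close> are the two centred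
  parts: only labelled data contribute to the first, all data to the second.\<close>

definition i_c :: "(real^'f) \<times> real \<Rightarrow> real" where "i_c z = - q * (I (fst z) - p)"

lemma measurable_y_c [measurable]: "y_c \<in> borel_measurable (borel \<Otimes>\<^sub>M borel)"
  unfolding y_c_def[abs_def] by measurable

lemma measurable_i_c [measurable]: "i_c \<in> borel_measurable (borel \<Otimes>\<^sub>M borel)"
  unfolding i_c_def[abs_def] by measurable

text \<open>General coefficients treat both blocks at once: a labelled observation has a = 1 /
  \<open>\<gamma>\<close> and b = 1, an unlabelled one a = 0 and b = 1.\<close>

lemma combination_square:
  fixes a b :: real
  shows "integrable M (\<lambda>\<omega>. (a * y_c (X 0 \<omega>, Y 0 \<omega>) + b * i_c (X 0 \<omega>, Y 0 \<omega>))\<^sup>2)"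
    and "expectation (\<lambda>\<omega>. (a * y_c (X 0 \<omega>, Y 0 \<omega>) + b * i_c (X 0 \<omega>, Y 0 \<omega>))\<^sup>2) =
      a\<^sup>2 * (p * q - p\<^sup>2 * q\<^sup>2) - 2 * a * b * q * (p * q - p\<^sup>2 * q) + b\<^sup>2 * (q\<^sup>2 * (p - p\<^sup>2))"
    and "expectation (\<lambda>\<omega>. a * y_c (X 0 \<omega>, Y 0 \<omega>) + b * i_c (X 0 \<omega>, Y 0 \<omega>)) = 0"
proof -
  \<comment> \<open>Since I and Y take the values 0 and 1, the square is an affine function of I Y
    and I; these are its coefficients.\<close>
  define c1 where "c1 = a\<^sup>2 * (1 - 2 * (p * q)) - 2 * a * b * q * (1 - p)"
  define c2 where "c2 = 2 * a * b * q * (p * q) + b\<^sup>2 * q\<^sup>2 * (1 - 2 * p)"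
  define c3 where "c3 = a\<^sup>2 * (p * q)\<^sup>2 - 2 * a * b * q * (p * (p * q)) + b\<^sup>2 * q\<^sup>2 * p\<^sup>2"
  have eq: "(a * y_c (X 0 \<omega>, Y 0 \<omega>) + b * i_c (X 0 \<omega>, Y 0 \<omega>))\<^sup>2 =
      c1 * (I (X 0 \<omega>) * Y 0 \<omega>) + c2 * I (X 0 \<omega>) + c3" if "\<omega> \<in> space M" for \<omega>
  proof -
    have "Y 0 \<omega> = 0 \<or> Y 0 \<omega> = 1" "I (X 0 \<omega>) = 0 \<or> I (X 0 \<omega>) = 1"
      using Y_01[OF that, of 0] by (auto simp: indicator_def)
    then show ?thesis
      unfolding y_c_def i_c_def c1_def c2_def c3_def fst_conv snd_conv
      by (elim disjE; simp only:; simp add: power2_eq_square algebra_simps)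
  qed
  show "integrable M (\<lambda>\<omega>. (a * y_c (X 0 \<omega>, Y 0 \<omega>) + b * i_c (X 0 \<omega>, Y 0 \<omega>))\<^sup>2)"
    using integrable_IY integrable_I
    by (subst Bochner_Integration.integrable_cong[OF refl eq]) auto
  have "expectation (\<lambda>\<omega>. (a * y_c (X 0 \<omega>, Y 0 \<omega>) + b * i_c (X 0 \<omega>, Y 0 \<omega>))\<^sup>2) = c1 * (p * q) + c2 * p + c3"
    using integrable_IY integrable_I
    by (subst Bochner_Integration.integral_cong[OF refl eq])
      (auto simp: expectation_IY expectation_I prob_space)
  then show "expectation (\<lambda>\<omega>. (a * y_c (X 0 \<omega>, Y 0 \<omega>) + b * i_c (X 0 \<omega>, Y 0 \<omega>))\<^sup>2) =
      a\<^sup>2 * (p * q - p\<^sup>2 * q\<^sup>2) - 2 * a * b * q * (p * q - p\<^sup>2 * q) + b\<^sup>2 * (q\<^sup>2 * (p - p\<^sup>2))"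
    unfolding c1_def c2_def c3_def by (simp add: power2_eq_square algebra_simps)
  show "expectation (\<lambda>\<omega>. a * y_c (X 0 \<omega>, Y 0 \<omega>) + b * i_c (X 0 \<omega>, Y 0 \<omega>)) = 0"
    using integrable_IY integrable_I
    by (simp add: y_c_def i_c_def expectation_IY expectation_I prob_space)
qed

lemma centred_L2_combination: "centred_L2 (\<lambda>z. a * y_c z + b * i_c z)"
  using combination_square[of a b] by (simp add: centred_L2_def)

definition N_bar :: "nat \<Rightarrow> 'a \<Rightarrow> real" where
  "N_bar n \<omega> = sqrt (real n) * ((\<Sum>i=1..r n. I (X i \<omega>) * Y i \<omega>) / real (r n) - q * D n \<omega>)"

lemma measurable_N_bar [measurable]: "N_bar n \<in> borel_measurable M"
  unfolding N_bar_def[abs_def] by measurable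

text \<open>No expansion is involved here: for r > 0 the identity is exact up to replacing n / r by
  its limit. The factors 1 and 0 keep the summands in the shape to which
  \<open>combination_square\<close> applies.\<close>

lemma N_bar_linear:
  "tendsto_0_in_prob M (\<lambda>n \<omega>. N_bar n \<omega> - block_sum (\<lambda>z. (1 / \<gamma>) * y_c z + 1 * i_c z) (\<lambda>z. 0 * y_c z + 1 * i_c z) n \<omega>)"
proof -
  let ?S = "block_sum y_c (\<lambda>_. 0)"
  have [measurable]: "?S n \<in> borel_measurable M" for n
    by (intro borel_measurable_block_sum) auto
  have y: "centred_L2 y_c" using centred_L2_combination[of 1 0] by simp
  have "(\<lambda>n. real n / real (r n) - 1 / \<gamma>) \<longlonglongrightarrow> 0"
    using inverse_r_lim by (rule LIM_zero)
  then have *: "tendsto_0_in_prob M (\<lambda>n \<omega>. ?S n \<omega> * (real n / real (r n) - 1 / \<gamma>))"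
    by (intro tendsto_0_in_prob_mult bounded_in_prob_block_sum tendsto_0_in_prob_const y) auto
  show ?thesis
  proof (rule tendsto_0_in_prob_cong[OF *])
    show "\<forall>\<^sub>F n in sequentially. \<forall>\<omega>\<in>space M.
      N_bar n \<omega> - block_sum (\<lambda>z. (1 / \<gamma>) * y_c z + 1 * i_c z) (\<lambda>z. 0 * y_c z + 1 * i_c z) n \<omega> =
      ?S n \<omega> * (real n / real (r n) - 1 / \<gamma>)"
      using r_pos_ev
    proof eventually_elim
      case (elim n)
      have n: "n > 0" using elim r_le[of n] by simp
      show ?case
      proof
        fix \<omega>
        have b: "block_sum (\<lambda>z. (1 / \<gamma>) * y_c z + 1 * i_c z) (\<lambda>z. 0 * y_c z + 1 * i_c z) n \<omega> =
            (1 / \<gamma>) * ?S n \<omega> + block_sum i_c i_c n \<omega>"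
          unfolding block_sum_cmult block_sum_add by simp
        define s t where "s = (\<Sum>i=1..r n. I (X i \<omega>) * Y i \<omega>)" and "t = (\<Sum>i=1..n. I (X i \<omega>))"
        have S: "?S n \<omega> = (s - real (r n) * (p * q)) / sqrt (real n)"
          by (simp add: block_sum_labelled y_c_def sum_subtractf s_def)
        have T: "block_sum i_c i_c n \<omega> = - q * (t - real n * p) / sqrt (real n)"
          by (simp add: block_sum_all i_c_def sum_distrib_left[symmetric] sum_subtractf t_def sum_negf)
        have "?S n \<omega> * (real n / real (r n)) = sqrt (real n) * (s / real (r n) - p * q)"
          using n elim unfolding S by (simp add: field_simps)
        moreover have "block_sum i_c i_c n \<omega> = sqrt (real n) * (- q * (t / real n) + q * p)"
        proof -
          have "- q * (t - u * u * p) / u = u * (- q * (t / (u * u)) + q * p)" if "u > 0" for u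
            using that by (simp add: field_simps)
          from this[of "sqrt (real n)"] show ?thesis using n unfolding T by simp
        qed
        ultimately show "N_bar n \<omega> - block_sum (\<lambda>z. (1 / \<gamma>) * y_c z + 1 * i_c z) (\<lambda>z. 0 * y_c z + 1 * i_c z) n \<omega> =
            ?S n \<omega> * (real n / real (r n) - 1 / \<gamma>)"
          unfolding b N_bar_def D_def s_def[symmetric] t_def[symmetric] by (simp add: algebra_simps)
      qed
    qed
  qed measurable
qed

definition "V_bar = (\<gamma> * ((1 / \<gamma>)\<^sup>2 * (p * q - p\<^sup>2 * q\<^sup>2) - 2 * (1 / \<gamma>) * q * (p * q - p\<^sup>2 * q) + q\<^sup>2 * (p - p\<^sup>2))
  + (1 - \<gamma>) * (q\<^sup>2 * (p - p\<^sup>2))) / p\<^sup>2"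

lemma Y_bar_limit: "has_limiting_variance M (Y_bar r W X Y) q V_bar"
proof -
  let ?f = "\<lambda>z. (1 / \<gamma>) * y_c z + 1 * i_c z" and ?h = "\<lambda>z. 0 * y_c z + 1 * i_c z"
  have "has_limiting_variance M (Y_bar r W X Y) q
    ((\<gamma> * expectation (\<lambda>\<omega>. (?f (X 0 \<omega>, Y 0 \<omega>))\<^sup>2) +
      (1 - \<gamma>) * expectation (\<lambda>\<omega>. (?h (X 0 \<omega>, Y 0 \<omega>))\<^sup>2)) / p\<^sup>2)"
  proof (rule ratio_limiting_variance[OF centred_L2_combination centred_L2_combination _ measurable_D
        measurable_N_bar N_bar_linear D_law p_pos])
    show "Y_bar r W X Y n \<in> borel_measurable M" for n
      unfolding Y_bar_def[abs_def] by measurable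
    fix n \<omega> assume "D n \<omega> \<noteq> 0"
    moreover have "Y_bar r W X Y n \<omega> = (\<Sum>i=1..r n. I (X i \<omega>) * Y i \<omega>) / real (r n) / D n \<omega>"
      by (simp add: Y_bar_def D_def)
    ultimately show "sqrt (real n) * (Y_bar r W X Y n \<omega> - q) = N_bar n \<omega> / D n \<omega>"
      unfolding N_bar_def by (simp add: field_simps)
  qed
  then show ?thesis unfolding combination_square by (simp add: V_bar_def)
qed

section \<open>Comparison of the two limiting variances\<close>

lemma V_difference: "p\<^sup>2 * (V_bar - V_hat) = (p * q - p\<^sup>2 * q\<^sup>2) / \<gamma> + p\<^sup>2 * q\<^sup>2 - \<kappa> - (B \<bullet> c) / \<gamma>"
proof -
  have 1: "p\<^sup>2 * V_hat = \<kappa> - q\<^sup>2 * p + (B \<bullet> c) / \<gamma>"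
    using p_pos \<gamma>_pos by (simp add: V_hat_def power2_eq_square field_simps)
  have 2: "p\<^sup>2 * V_bar = (p * q - p\<^sup>2 * q\<^sup>2) / \<gamma> - 2 * q * (p * q - p\<^sup>2 * q) + q\<^sup>2 * (p - p\<^sup>2)"
    using p_pos \<gamma>_pos by (simp add: V_bar_def power2_eq_square field_simps)
  show ?thesis
    unfolding right_diff_distrib 1 2 by (simp add: power2_eq_square algebra_simps)
qed

text \<open>The variance p q - p^2 q^2 of I Y splits into the residual part p q -
  \<open>\<kappa>\<close>, which pays for B \<bullet> c, and the variance \<open>\<kappa>\<close> -
  p^2 q^2 of I g. In the difference the latter appears divided by \<open>\<gamma>\<close> with a
  plus sign and undivided with a minus sign.\<close>

lemma V_difference_ge: "(1 / \<gamma> - 1) * (\<kappa> - p\<^sup>2 * q\<^sup>2) \<le> p\<^sup>2 * (V_bar - V_hat)"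
proof -
  have "(B \<bullet> c) / \<gamma> \<le> (p * q - \<kappa>) / \<gamma>"
    using B_c_le \<gamma>_pos by (intro divide_right_mono) auto
  then show ?thesis
    unfolding V_difference by (simp add: algebra_simps diff_divide_distrib)
qed

lemma V_hat_le: "V_hat \<le> V_bar"
proof -
  have "0 \<le> \<kappa> - p\<^sup>2 * q\<^sup>2"
    unfolding variance_Ig[symmetric] by (intro integral_nonneg_AE) auto
  then have "0 \<le> (1 / \<gamma> - 1) * (\<kappa> - p\<^sup>2 * q\<^sup>2)"
    using \<gamma>_pos \<gamma>_le by (intro mult_nonneg_nonneg) auto
  with V_difference_ge have "0 \<le> p\<^sup>2 * (V_bar - V_hat)" by linarith
  then show ?thesis using p_pos by (simp add: zero_le_mult_iff)
qed

lemma V_hat_less: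
  assumes "\<gamma> < 1" and nonconst: "\<not> (\<exists>c. AE \<omega> in M. I (X 0 \<omega>) * g0 (X 0 \<omega>) = c)"
  shows "V_hat < V_bar"
proof -
  \<comment> \<open>Zero variance would make I g almost surely equal to its mean p q.\<close>
  have "\<kappa> - p\<^sup>2 * q\<^sup>2 \<noteq> 0"
  proof
    assume "\<kappa> - p\<^sup>2 * q\<^sup>2 = 0"
    then have "AE \<omega> in M. (I (X 0 \<omega>) * g0 (X 0 \<omega>) - p * q)\<^sup>2 = 0"
      using integral_nonneg_eq_0_iff_AE[OF integrable_variance_Ig] variance_Ig by simp
    then have "AE \<omega> in M. I (X 0 \<omega>) * g0 (X 0 \<omega>) = p * q" by simp
    with nonconst show False by blast
  qed
  moreover have "0 \<le> \<kappa> - p\<^sup>2 * q\<^sup>2"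
    unfolding variance_Ig[symmetric] by (intro integral_nonneg_AE) auto
  ultimately have "0 < (1 / \<gamma> - 1) * (\<kappa> - p\<^sup>2 * q\<^sup>2)"
    using \<gamma>_pos assms(1) by (intro mult_pos_pos) auto
  with V_difference_ge have "0 < p\<^sup>2 * (V_bar - V_hat)" by linarith
  then show ?thesis using p_pos by (simp add: zero_less_mult_iff)
qed

end

theorem corollary2:
  fixes M :: "'a measure"
    and X :: "nat \<Rightarrow> 'a \<Rightarrow> real^'f"
    and Y :: "nat \<Rightarrow> 'a \<Rightarrow> real"
    and r :: "nat \<Rightarrow> nat"
    and \<gamma> :: real
    and g :: "real^'f \<Rightarrow> real^'p \<Rightarrow> real"
    and \<Theta> U :: "(real^'p) set"
    and \<theta> :: "real^'p"
    and est :: "nat \<Rightarrow> (nat \<Rightarrow> (real^'f) \<times> real) \<Rightarrow> real^'p"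
    and A :: "real^'p^'p"
    and \<theta>hat :: "nat \<Rightarrow> 'a \<Rightarrow> real^'p"
    and W :: "(real^'f) set"
    and q :: real
  assumes prob: "prob_space M"
    \<comment> \<open>the generic pair (index 0) and the sample are i.i.d.\<close>
    and indep: "prob_space.indep_vars M (\<lambda>_. borel \<Otimes>\<^sub>M borel) (\<lambda>i \<omega>. (X i \<omega>, Y i \<omega>)) UNIV"
    and ident: "\<And>i. distr M (borel \<Otimes>\<^sub>M borel) (\<lambda>\<omega>. (X i \<omega>, Y i \<omega>)) =
                     distr M (borel \<Otimes>\<^sub>M borel) (\<lambda>\<omega>. (X 0 \<omega>, Y 0 \<omega>))"
    and Y_01: "\<And>i \<omega>. \<omega> \<in> space M \<Longrightarrow> Y i \<omega> \<in> {0, 1}"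
    \<comment> \<open>number of labelled observations\<close>
    and r_le: "\<And>n. r n \<le> n"
    and r_lim: "(\<lambda>n. real (r n) / real n) \<longlonglongrightarrow> \<gamma>"
    and \<gamma>: "0 < \<gamma>" "\<gamma> \<le> 1"
    \<comment> \<open>semiparametric model\<close>
    and \<theta>_interior: "\<theta> \<in> interior \<Theta>"
    and g_measurable: "(\<lambda>(t, \<eta>). g t \<eta>) \<in> borel_measurable (restrict_space borel (UNIV \<times> \<Theta>))"
    and g_bounds: "\<And>t \<eta>. \<eta> \<in> \<Theta> \<Longrightarrow> 0 < g t \<eta> \<and> g t \<eta> < 1"
    and model: "AE \<omega> in M. real_cond_exp M (vimage_algebra (space M) (X 0) borel)
                  (indicator {\<omega>' \<in> space M. Y 0 \<omega>' = 1}) \<omega> = g (X 0 \<omega>) \<theta>"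
    \<comment> \<open>regularity of g near the true parameter\<close>
    and U: "open U" "convex U" "\<theta> \<in> U" "U \<subseteq> \<Theta>"
    and g_diff: "\<And>t \<eta>. \<eta> \<in> U \<Longrightarrow> g t differentiable (at \<eta>)"
    and g_cont_diff: "\<And>t. continuous_on U (gradient (g t))"
    and g_dom: "(\<integral>\<^sup>+ \<omega>. (SUP \<eta>\<in>U. ennreal (norm (gradient (g (X 0 \<omega>)) \<eta>))) \<partial>M) < \<infinity>"
    and A_finite: "integrable M (\<lambda>\<omega>. info g (X 0 \<omega>) \<theta>)"
    and A_def: "A = (\<integral>\<omega>. info g (X 0 \<omega>) \<theta> \<partial>M)"
    and A_invertible: "invertible A"
    \<comment> \<open>the weighted least squares estimator: a root of the estimating equation with probability tending to 1\<close>
    and est_measurable: "\<And>n. est n \<in> (\<Pi>\<^sub>M i\<in>{1..r n}. borel \<Otimes>\<^sub>M borel) \<rightarrow>\<^sub>M borel"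
    and est_param: "\<And>n d. est n d \<in> \<Theta>"
    and \<theta>hat_def: "\<theta>hat = param_est est r X Y"
    and \<theta>hat_root: "\<exists>E. (\<forall>n. E n \<in> sets M) \<and> (\<lambda>n. measure M (E n)) \<longlonglongrightarrow> 1 \<and>
          (\<forall>n. \<forall>\<omega>\<in>E n. (\<Sum>i=1..r n. score g (X i \<omega>) (Y i \<omega>) (\<theta>hat n \<omega>)) = 0)"
    and \<theta>hat_linear: "tendsto_0_in_prob M (\<lambda>n \<omega>.
          sqrt (real (r n)) *\<^sub>R (\<theta>hat n \<omega> - \<theta>) -
          (1 / sqrt (real (r n))) *\<^sub>R
            (matrix_inv A *v (\<Sum>i=1..r n. score g (X i \<omega>) (Y i \<omega>) \<theta>)))"
    \<comment> \<open>the set of feature values\<close>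
    and W: "W \<in> sets borel"
    and W_pos: "\<P>(\<omega> in M. X 0 \<omega> \<in> W) > 0"
    and q_def: "q = \<P>(\<omega> in M. Y 0 \<omega> = 1 \<bar> X 0 \<omega> \<in> W)"
  shows "\<exists>V_hat V_bar.
      has_limiting_variance M (q_hat g W X \<theta>hat) q V_hat \<and>
      has_limiting_variance M (Y_bar r W X Y) q V_bar \<and>
      V_hat \<le> V_bar \<and>
      (\<gamma> < 1 \<and> \<not> (\<exists>c. AE \<omega> in M. indicator W (X 0 \<omega>) * g (X 0 \<omega>) \<theta> = c) \<longrightarrow> V_hat < V_bar)"
proof -
  have Z: "labelled_sample M (borel \<Otimes>\<^sub>M borel) (\<lambda>i \<omega>. (X i \<omega>, Y i \<omega>)) r \<gamma>"
    using prob indep ident r_le r_lim \<gamma> by (intro labelled_sample.intro labelled_sample_axioms.intro) auto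
  have model': "semiparametric_model M X Y r \<gamma> g \<Theta> U \<theta>"
    using Z Y_01 g_measurable g_bounds model U g_diff g_cont_diff g_dom A_finite
    by (intro semiparametric_model.intro semiparametric_model_axioms.intro) auto
  interpret model: semiparametric_model M X Y r \<gamma> g \<Theta> U \<theta>
    by (rule model')
  have A: "A = model.A" by (simp add: A_def model.A_def)
  have pair: "(\<lambda>\<omega>. (X i \<omega>, Y i \<omega>)) \<in> measurable M (borel \<Otimes>\<^sub>M borel)" for i
    by (rule model.measurable_Z)
  have \<theta>hat_measurable: "\<theta>hat n \<in> borel_measurable M" for n
    unfolding \<theta>hat_def param_est_def[abs_def]
    by (rule measurable_compose[OF measurable_restrict[OF pair] est_measurable])
  have \<theta>hat_in: "\<theta>hat n \<omega> \<in> \<Theta>" for n \<omega>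
    by (simp add: \<theta>hat_def param_est_def est_param)
  note q = q_def
  interpret weighted_least_squares M X Y r \<gamma> g \<Theta> U \<theta> \<theta>hat W
    using model' \<theta>hat_measurable \<theta>hat_in A_invertible \<theta>hat_linear W W_pos unfolding A
    by (intro weighted_least_squares.intro weighted_least_squares_axioms.intro) auto
  \<comment> \<open>The variable \<open>q\<close> of the statement is a conditional probability, the
    locale constant a quotient of expectations; the limit laws are centred at the latter.\<close>
  have "q = weighted_least_squares.q M X g \<theta> W"
    unfolding q by (rule q_cond_prob[symmetric])
  then show ?thesis
    using q_hat_limit Y_bar_limit V_hat_le V_hat_less by blast
qed

end
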